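(* Let $0<\nu\le\frac12$ and $\lambda>0$. The $t$-Laplace transform $\widetilde{\mathfrak{h}_\nu}(x,\mu)=\int_0^\infty e^{-\mu t}\,\mathfrak{h}_\nu(x,t)\,dt$ of the law $\mathfrak{h}_\nu(x,t)$ of $\mathcal{H}^\nu(t)=H_1^{2\nu}(t)+(2\lambda)^{1/\nu}H_2^\nu(t)$ is, for $x>0$ and $0<\mu<\lambda^2$, $$\widetilde{\mathfrak{h}_\nu}(x,\mu)=\frac{x^{\nu-1}}{2\sqrt{\lambda^2-\mu}}\left[E_{\nu,\nu}\left(\left(-\lambda+\sqrt{\lambda^2-\mu}\right)x^\nu\right)-E_{\nu,\nu}\left(\left(-\lambda-\sqrt{\lambda^2-\mu}\right)x^\nu\right)\right]$$ $$=\frac{1}{2\sqrt{\lambda^2-\mu}}\left[\frac{1}{-\lambda+\sqrt{\lambda^2-\mu}}\frac{\partial}{\partial x}E_{\nu,1}\left(\left(-\lambda+\sqrt{\lambda^2-\mu}\right)x^\nu\right)-\frac{1}{-\lambda-\sqrt{\lambda^2-\mu}}\frac{\partial}{\partial x}E_{\nu,1}\left(\left(-\lambda-\sqrt{\lambda^2-\mu}\right)x^\nu\right)\right].$$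
   Context: For $0<\alpha<1$, $H^\alpha(t)$, $t>0$, is the stable subordinator with $\mathbb{E}e^{-\mu H^\alpha(t)}=e^{-t\mu^\alpha}$, $\mu>0$; for $\alpha=1$, $H^1(t)=t$. $H_1^{2\nu}$ and $H_2^\nu$ are independent, of orders $2\nu$ and $\nu$. $\mathfrak{h}_\nu(x,t)$ is the probability density of $\mathcal{H}^\nu(t)$ in $x\ge0$. The Mittag-Leffler function is $E_{\nu,\psi}(x)=\sum_{k=0}^\infty\frac{x^k}{\Gamma(\nu k+\psi)}$, $\nu,\psi>0$. *)

theory Defs
  imports "HOL-Probability.Probability"
begin

definition mittag_leffler :: "real \<Rightarrow> real \<Rightarrow> real \<Rightarrow> real" where
  "mittag_leffler \<nu> \<psi> x = (\<Sum>k. x ^ k / Gamma (\<nu> * real k + \<psi>))"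

text \<open>
  A subordinator is a Levy process with almost surely nondecreasing paths; left limits
  need not be required because they exist along monotone paths. Time runs over \<open>{0..}\<close>;
  the values of \<open>H\<close> at negative times are irrelevant.
\<close>

definition subordinator :: "'a measure \<Rightarrow> (real \<Rightarrow> 'a \<Rightarrow> real) \<Rightarrow> bool" where
  "subordinator M H \<longleftrightarrow>
     prob_space M \<and>
     (\<forall>t\<ge>0. H t \<in> borel_measurable M) \<and>
     (AE \<omega> in M. H 0 \<omega> = 0) \<and>
     (\<forall>(n::nat) (t::nat \<Rightarrow> real). 0 \<le> t 0 \<and> mono_on {..n} t \<longrightarrow>
        prob_space.indep_vars M (\<lambda>_. borel) (\<lambda>i \<omega>. H (t (Suc i)) \<omega> - H (t i) \<omega>) {..<n}) \<and>
     (\<forall>s\<ge>0. \<forall>t\<ge>0. distr M borel (\<lambda>\<omega>. H (s + t) \<omega> - H s \<omega>) = distr M borel (H t)) \<and>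
     (AE \<omega> in M. mono_on {0..} (\<lambda>t. H t \<omega>) \<and>
        (\<forall>t\<ge>0. continuous (at_right t) (\<lambda>s. H s \<omega>)))"

definition stable_subordinator :: "'a measure \<Rightarrow> real \<Rightarrow> (real \<Rightarrow> 'a \<Rightarrow> real) \<Rightarrow> bool" where
  "stable_subordinator M \<alpha> H \<longleftrightarrow>
     (0 < \<alpha> \<and> \<alpha> < 1 \<and> subordinator M H \<and>
        (\<forall>t>0. \<forall>\<mu>>0. prob_space.expectation M (\<lambda>\<omega>. exp (- \<mu> * H t \<omega>)) = exp (- t * \<mu> powr \<alpha>)))
     \<or> (\<alpha> = 1 \<and> (\<forall>t\<ge>0. \<forall>\<omega>\<in>space M. H t \<omega> = t))"

text \<open>Independence of whole processes, i.e. of the random elements of the path space.\<close>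

definition indep_processes ::
    "'a measure \<Rightarrow> (real \<Rightarrow> 'a \<Rightarrow> real) \<Rightarrow> (real \<Rightarrow> 'a \<Rightarrow> real) \<Rightarrow> bool" where
  "indep_processes M X Y \<longleftrightarrow>
     prob_space.indep_var M
       (Pi\<^sub>M {0..} (\<lambda>_. borel)) (\<lambda>\<omega>. \<lambda>t\<in>{0..}. X t \<omega>)
       (Pi\<^sub>M {0..} (\<lambda>_. borel)) (\<lambda>\<omega>. \<lambda>t\<in>{0..}. Y t \<omega>)"

text \<open>
  \<open>h x t\<close> is the probability density of \<open>X t\<close> at \<open>x\<close>. A density is determined only up to
  null sets in \<open>x\<close>, separately for each \<open>t\<close>, so its Laplace transform in \<open>t\<close> at a given
  \<open>x > 0\<close> has a meaning only for a fixed version; continuity in \<open>x > 0\<close> singles it out.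
\<close>

definition law_density ::
    "'a measure \<Rightarrow> (real \<Rightarrow> 'a \<Rightarrow> real) \<Rightarrow> (real \<Rightarrow> real \<Rightarrow> real) \<Rightarrow> bool" where
  "law_density M X h \<longleftrightarrow>
     (\<forall>t>0. (\<forall>x. 0 \<le> h x t) \<and>
            distributed M lborel (X t) (\<lambda>x. ennreal (h x t)) \<and>
            continuous_on {0<..} (\<lambda>x. h x t))"

end

theory Submission imports Defs begin

text \<open>
  Independence and the subordinators' exponents give the \<open>x\<close>-Laplace transform
  \<open>exp (- t \<psi>(\<gamma>))\<close> of \<open>h(\<cdot>,t)\<close>, where \<open>\<psi>(\<gamma>) = \<gamma>\<^bsup>2\<nu>\<^esup> + 2 l \<gamma>\<^bsup>\<nu>\<^esup>\<close>; integrating against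
  \<open>exp (- \<mu> t)\<close> in \<open>t\<close> yields \<open>1 / (\<mu> + \<psi>(\<gamma>))\<close>, whose partial fractions in \<open>\<gamma>\<^bsup>\<nu>\<^esup>\<close> are the
  transforms of the two Mittag-Leffler terms. Uniqueness of Laplace transforms proves the
  formula for almost every \<open>x\<close>. The remaining difficulty is to obtain it at every \<open>x > 0\<close>,
  that is, to show that the \<open>t\<close>-transform is continuous in \<open>x\<close> although only each single
  \<open>h(\<cdot>,t)\<close> is known to be continuous. For \<open>\<nu> < 1/2\<close> this follows from the size-biasing identity
  \<open>x h(x,t) = t (k * h(\<cdot>,t))(x)\<close>, where \<open>\<psi>'\<close> is the transform of \<open>k\<close>. For \<open>\<nu> = 1/2\<close> the drift
  makes the identity useless, but there the density is a shifted one whose transform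
  \<open>exp (- 2 l t \<surd>\<gamma>)\<close> yields a locally uniform bound, and dominated convergence applies.
\<close>

section \<open>Laplace transforms\<close>

text \<open>\<open>law_density\<close> says nothing about how h(x,t) depends on t, so even
  measurability in t has to be earned: nondecreasing paths make P(X_t \<le> y) antitone in t, and
  h(x,t) is a limit of difference quotients of this function in y. Transforms take values in
  [0, \<infinity>], which removes integrability conditions but excludes signed functions; the
  nonnegativity of the Mittag-Leffler difference must therefore come out of the argument instead of
  entering it. Size biasing helps because convolution smooths: the factors need only be finite and
  continuous on the positive half line and integrable at 0, and no bound on h uniform in t is
  required. For \<nu> = 1/2 the derivative of \<psi> contains the constant 1, the transform of a
  unit mass at 0, so the identity becomes (x - t) h(x,t) = t (k * h(.,t))(x), which degenerates at t
  = x. The bound on h matters exactly there: the shifted density is then evaluated close to 0, where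
  it is exponentially small.\<close>

lemma real_distribution_eqI_moments:
  assumes M: "real_distribution M" and N: "real_distribution N"
    and Mb: "AE x in M. x \<in> {0..1}" and Nb: "AE x in N. x \<in> {0..1}"
    and moments: "\<And>n::nat. (\<integral>x. x ^ n \<partial>M) = (\<integral>x. x ^ n \<partial>N)"
  shows "M = N"
proof (rule Levy_uniqueness[OF M N])
  \<comment> \<open>The error after n terms of the expansion of \<open>char P\<close> is at most 2
    |t|^n / n! times the n-th absolute moment, and on the unit interval that moment is at most 1.
    Hence the moments determine the characteristic function.\<close>
  have lim: "(\<lambda>n. \<Sum>k\<le>n. (\<i> * t) ^ k / fact k * (\<integral>x. x ^ k \<partial>P)) \<longlonglongrightarrow> char P t"
    if P: "real_distribution P" and b: "AE x in P. x \<in> {0..1}" for P t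
  proof -
    interpret P: real_distribution P by fact
    have int: "integrable P (\<lambda>x. x ^ k)" for k :: nat
      using b by (intro P.integrable_const_bound[where B=1]) (elim eventually_mono, auto intro: power_le_one)
    have "\<bar>x ^ k\<bar> \<le> 1" if "x \<in> {0..1}" for x :: real and k :: nat
      using that by (auto intro: power_le_one simp: power_abs)
    then have "(\<integral>x. \<bar>x\<bar> ^ k \<partial>P) \<le> (\<integral>x. 1 \<partial>P)" for k :: nat
      unfolding power_abs[symmetric]
      by (intro integral_mono_AE) (use b int in \<open>auto elim: eventually_mono\<close>)
    then have le: "(\<integral>x. \<bar>x\<bar> ^ k \<partial>P) \<le> 1" for k :: nat
      using P.prob_space by simp
    have "(\<lambda>n. 2 * (\<bar>t\<bar> ^ n / fact n)) \<longlonglongrightarrow> 2 * 0"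
      by (intro tendsto_mult tendsto_const)
        (use summable_LIMSEQ_zero[OF summable_exp[of "\<bar>t\<bar>"]] in \<open>simp add: field_simps\<close>)
    then have zero: "(\<lambda>n. 2 * \<bar>t\<bar> ^ n / fact n) \<longlonglongrightarrow> 0"
      by simp
    have "(\<lambda>n. char P t - (\<Sum>k\<le>n. (\<i> * t) ^ k / fact k * (\<integral>x. x ^ k \<partial>P))) \<longlonglongrightarrow> 0"
    proof (rule Lim_null_comparison[OF _ zero], intro always_eventually allI)
      fix n
      have "cmod (char P t - (\<Sum>k\<le>n. (\<i> * t) ^ k / fact k * (\<integral>x. x ^ k \<partial>P)))
        \<le> (2 * \<bar>t\<bar> ^ n / fact n) * (\<integral>x. \<bar>x\<bar> ^ n \<partial>P)"
        by (rule P.char_approx1) (rule int)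
      also have "\<dots> \<le> (2 * \<bar>t\<bar> ^ n / fact n) * 1"
        by (intro mult_left_mono le) auto
      finally show "norm (char P t - (\<Sum>k\<le>n. (\<i> * t) ^ k / fact k * (\<integral>x. x ^ k \<partial>P)))
        \<le> 2 * \<bar>t\<bar> ^ n / fact n" by simp
    qed
    then show ?thesis
      by (rule LIM_zero_cancel[OF tendsto_minus_cancel, simplified])
  qed
  show "char M = char N"
  proof
    fix t
    show "char M t = char N t"
      using lim[OF M Mb, of t] lim[OF N Nb, of t] unfolding moments
      by (rule LIMSEQ_unique)
  qed
qed

text \<open>Values in \<open>ennreal\<close> allow infinite transforms and Tonelli's theorem without
  side conditions; the indicator makes the values of \<open>f\<close> off the positive half line
  irrelevant.\<close>

definition laplace :: "(real \<Rightarrow> ennreal) \<Rightarrow> real \<Rightarrow> ennreal" where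
  "laplace f \<gamma> = (\<integral>\<^sup>+x. ennreal (exp (- \<gamma> * x)) * f x * indicator {0<..} x \<partial>lborel)"

lemma laplace_cmult:
  assumes [measurable]: "f \<in> borel_measurable borel"
  shows "laplace (\<lambda>x. c * f x) \<gamma> = c * laplace f \<gamma>"
  unfolding laplace_def by (subst nn_integral_cmult[symmetric]) (auto simp: ac_simps)

lemma laplace_add:
  assumes [measurable]: "f \<in> borel_measurable borel" "g \<in> borel_measurable borel"
  shows "laplace (\<lambda>x. f x + g x) \<gamma> = laplace f \<gamma> + laplace g \<gamma>"
  unfolding laplace_def by (subst nn_integral_add[symmetric]) (auto simp: algebra_simps)

text \<open>
  The substitution \<open>y = exp (- x)\<close> turns the values of the transform along
  \<open>\<gamma>\<^sub>0 + \<nat>\<close> into the moments of a finite measure on the unit interval.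
\<close>

theorem laplace_unique:
  assumes [measurable]: "f \<in> borel_measurable borel" "g \<in> borel_measurable borel"
    and eq: "\<And>n::nat. laplace f (\<gamma>\<^sub>0 + real n) = laplace g (\<gamma>\<^sub>0 + real n)"
    and fin: "laplace f \<gamma>\<^sub>0 < \<infinity>"
  shows "AE x in lborel. 0 < x \<longrightarrow> f x = g x"
proof (cases "laplace f \<gamma>\<^sub>0 = 0")
  \<comment> \<open>A vanishing transform cannot be normalised to a probability measure, so this
    case is settled directly: both functions are 0 almost everywhere on the half line.\<close>
  case True
  then have "laplace g \<gamma>\<^sub>0 = 0"
    using eq[of 0] by simp
  with True have "AE x in lborel. ennreal (exp (- \<gamma>\<^sub>0 * x)) * f x * indicator {0<..} x = 0"
    "AE x in lborel. ennreal (exp (- \<gamma>\<^sub>0 * x)) * g x * indicator {0<..} x = 0"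
    unfolding laplace_def by (simp_all add: nn_integral_0_iff_AE)
  then show ?thesis
    by eventually_elim (auto simp: indicator_def)
next
  case False
  \<comment> \<open>Dividing the weight exp (- \<gamma>0 x) f(x) by its total mass \<open>c\<close>
    makes it a probability density; \<open>E\<close> is its image under x -> exp (- x).\<close>
  define c where "c = laplace f \<gamma>\<^sub>0"
  have c: "0 < c" "c < \<infinity>"
    using False fin unfolding c_def by (auto simp: zero_less_iff_neq_zero)
  define w where "w u x = ennreal (exp (- \<gamma>\<^sub>0 * x)) * u x * indicator {0<..} x / c"
    for u :: "real \<Rightarrow> ennreal" and x
  define D where "D u = density lborel (w u)" for u
  define E where "E u = distr (D u) borel (\<lambda>x. exp (- x))" for u
  have w[measurable]: "w f \<in> borel_measurable borel" "w g \<in> borel_measurable borel"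
    unfolding w_def by measurable
  have mom: "(\<integral>\<^sup>+y. ennreal (y ^ n) \<partial>E u) = laplace u (\<gamma>\<^sub>0 + real n) / c"
    if [measurable]: "u \<in> borel_measurable borel" for u and n :: nat
  proof -
    have [measurable]: "w u \<in> borel_measurable borel"
      unfolding w_def by measurable
    have "(\<integral>\<^sup>+y. ennreal (y ^ n) \<partial>E u) = (\<integral>\<^sup>+x. w u x * ennreal (exp (- x) ^ n) \<partial>lborel)"
      unfolding E_def D_def by (simp add: nn_integral_distr nn_integral_density)
    also have "\<dots> = (\<integral>\<^sup>+x. (ennreal (exp (- (\<gamma>\<^sub>0 + real n) * x)) * u x * indicator {0<..} x) / c \<partial>lborel)"
    proof (intro nn_integral_cong)
      fix x :: real
      have "exp (- (\<gamma>\<^sub>0 + real n) * x) = exp (- \<gamma>\<^sub>0 * x) * exp (- x) ^ n"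
        by (simp add: exp_of_nat_mult[symmetric] exp_add[symmetric] algebra_simps)
      then show "w u x * ennreal (exp (- x) ^ n) =
        ennreal (exp (- (\<gamma>\<^sub>0 + real n) * x)) * u x * indicator {0<..} x / c"
        by (simp add: w_def ennreal_mult divide_ennreal_def ac_simps)
    qed
    also have "\<dots> = laplace u (\<gamma>\<^sub>0 + real n) / c"
      unfolding laplace_def by (rule nn_integral_divide) measurable
    finally show ?thesis .
  qed
  have dist: "real_distribution (E u)"
    if [measurable]: "u \<in> borel_measurable borel" and "laplace u \<gamma>\<^sub>0 = c" for u
  proof -
    have "emeasure (E u) (space (E u)) = (\<integral>\<^sup>+y. ennreal (y ^ 0) \<partial>E u)"
      by simp
    also have "\<dots> = 1"
      using that(2) c by (subst mom) (auto simp: ennreal_divide_self)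
    finally have "prob_space (E u)"
      by (rule prob_spaceI)
    then show ?thesis
      by (simp add: real_distribution_def real_distribution_axioms_def E_def)
  qed
  have bnd: "AE y in E u. y \<in> {0..1}" if [measurable]: "u \<in> borel_measurable borel" for u
  proof -
    have [measurable]: "w u \<in> borel_measurable borel"
      unfolding w_def by measurable
    show ?thesis
      unfolding E_def D_def
      by (subst AE_distr_iff) (auto simp: AE_density w_def indicator_def intro!: AE_I2)
  qed
  have "E f = E g"
  proof (rule real_distribution_eqI_moments)
    fix n :: nat
    have "(\<integral>\<^sup>+y. ennreal (y ^ n) \<partial>E f) = (\<integral>\<^sup>+y. ennreal (y ^ n) \<partial>E g)"
      by (simp add: mom eq)
    moreover have "AE y in E f. 0 \<le> y ^ n" "AE y in E g. 0 \<le> y ^ n"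
      using bnd[of f] bnd[of g] by (auto elim!: eventually_mono)
    ultimately show "(\<integral>y. y ^ n \<partial>E f) = (\<integral>y. y ^ n \<partial>E g)"
      by (subst (1 2) integral_eq_nn_integral) (auto simp: E_def)
  qed (use dist bnd eq[of 0] in \<open>auto simp: c_def\<close>)
  \<comment> \<open>The substitution is invertible, so equality of the image measures carries back
    to the measures with densities \<open>w f\<close> and \<open>w g\<close>.\<close>
  moreover have D_eq: "D u = distr (E u) lborel (\<lambda>y. - ln y)" for u
  proof -
    have "distr (E u) lborel (\<lambda>y. - ln y) = distr (D u) lborel (\<lambda>x. x)"
      unfolding E_def by (subst distr_distr) (auto simp: comp_def D_def)
    also have "\<dots> = distr (D u) (D u) (\<lambda>x. x)"
      by (rule distr_cong) (auto simp: D_def)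
    finally show ?thesis
      by simp
  qed
  ultimately have "D f = D g"
    by metis
  moreover have "sigma_finite_measure (D f)"
  proof -
    interpret real_distribution "E f"
      by (rule dist) (auto simp: c_def)
    have "prob_space (distr (E f) lborel (\<lambda>y. - ln y))"
      by (rule prob_space_distr) (auto simp: E_def)
    then show ?thesis
      using D_eq[of f] by (simp add: prob_space_imp_sigma_finite)
  qed
  ultimately have "AE x in lborel. w f x = w g x"
    unfolding D_def by (subst (asm) sigma_finite_density_unique) auto
  then show ?thesis
  proof eventually_elim
    case (elim x)
    show ?case
    proof
      assume "0 < x"
      have "inverse c \<noteq> 0" "inverse c \<noteq> \<infinity>"
        using c by (auto simp: ennreal_inverse_eq_0_iff ennreal_inverse_eq_top_iff)
      moreover have "(ennreal (exp (- \<gamma>\<^sub>0 * x)) * inverse c) * f x = (ennreal (exp (- \<gamma>\<^sub>0 * x)) * inverse c) * g x"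
        using elim \<open>0 < x\<close> by (simp add: w_def divide_ennreal_def ac_simps)
      ultimately show "f x = g x"
        by (subst (asm) ennreal_mult_cancel_left)
          (auto simp: ennreal_mult_eq_top_iff)
    qed
  qed
qed

section \<open>Convolution on the positive half line\<close>

definition conv :: "(real \<Rightarrow> ennreal) \<Rightarrow> (real \<Rightarrow> ennreal) \<Rightarrow> real \<Rightarrow> ennreal" where
  "conv f g x = (\<integral>\<^sup>+y. (if 0 < y \<and> y < x then f (x - y) * g y else 0) \<partial>lborel)"

lemma borel_measurable_conv [measurable (raw)]:
  assumes [measurable]: "f \<in> borel_measurable borel" "g \<in> borel_measurable borel"
  shows "conv f g \<in> borel_measurable borel"
  unfolding conv_def by measurable

lemma laplace_conv:
  assumes [measurable]: "f \<in> borel_measurable borel" "g \<in> borel_measurable borel"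
  shows "laplace (conv f g) \<gamma> = laplace f \<gamma> * laplace g \<gamma>"
proof -
  let ?k = "\<lambda>x y. if 0 < y \<and> y < x then ennreal (exp (- \<gamma> * x)) * (f (x - y) * g y) else 0"
  have "laplace (conv f g) \<gamma> = (\<integral>\<^sup>+x. \<integral>\<^sup>+y. ?k x y \<partial>lborel \<partial>lborel)"
    unfolding laplace_def
  proof (intro nn_integral_cong)
    fix x :: real
    have "ennreal (exp (- \<gamma> * x)) * conv f g x * indicator {0<..} x =
      ennreal (exp (- \<gamma> * x)) * conv f g x"
    proof (cases "0 < x")
      case False
      then have "(\<lambda>y. if 0 < y \<and> y < x then f (x - y) * g y else 0) = (\<lambda>_. 0)"
        by (auto simp: fun_eq_iff)
      then have "conv f g x = 0"
        unfolding conv_def by simp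
      then show ?thesis by simp
    qed auto
    also have "\<dots> = (\<integral>\<^sup>+y. ?k x y \<partial>lborel)"
      unfolding conv_def by (subst nn_integral_cmult[symmetric]) (auto intro!: nn_integral_cong)
    finally show "ennreal (exp (- \<gamma> * x)) * conv f g x * indicator {0<..} x = (\<integral>\<^sup>+y. ?k x y \<partial>lborel)" .
  qed
  also have "\<dots> = (\<integral>\<^sup>+y. \<integral>\<^sup>+x. ?k x y \<partial>lborel \<partial>lborel)"
    by (rule lborel_pair.Fubini') measurable
  also have "\<dots> = (\<integral>\<^sup>+y. laplace f \<gamma> * (ennreal (exp (- \<gamma> * y)) * g y * indicator {0<..} y) \<partial>lborel)"
  proof (intro nn_integral_cong)
    fix y :: real
    have "(\<integral>\<^sup>+x. ?k x y \<partial>lborel) = (\<integral>\<^sup>+x. ?k (y + 1 * x) y \<partial>lborel)"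
      by (subst nn_integral_real_affine[where c=1 and t=y]) auto
    also have "\<dots> = (\<integral>\<^sup>+x. (ennreal (exp (- \<gamma> * x)) * f x * indicator {0<..} x)
        * (ennreal (exp (- \<gamma> * y)) * g y * indicator {0<..} y) \<partial>lborel)"
    proof (intro nn_integral_cong)
      fix x :: real
      have "exp (- \<gamma> * (y + 1 * x)) = exp (- \<gamma> * x) * exp (- \<gamma> * y)"
        by (simp add: exp_add[symmetric] algebra_simps)
      then show "?k (y + 1 * x) y = (ennreal (exp (- \<gamma> * x)) * f x * indicator {0<..} x)
        * (ennreal (exp (- \<gamma> * y)) * g y * indicator {0<..} y)"
        by (auto simp: indicator_def ennreal_mult ac_simps)
    qed
    also have "\<dots> = laplace f \<gamma> * (ennreal (exp (- \<gamma> * y)) * g y * indicator {0<..} y)"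
      unfolding laplace_def by (rule nn_integral_multc) measurable
    finally show "(\<integral>\<^sup>+x. ?k x y \<partial>lborel) =
      laplace f \<gamma> * (ennreal (exp (- \<gamma> * y)) * g y * indicator {0<..} y)" .
  qed
  also have "\<dots> = laplace f \<gamma> * laplace g \<gamma>"
    unfolding laplace_def by (rule nn_integral_cmult) measurable
  finally show ?thesis .
qed

text \<open>On (0,b) the weight exp (- \<gamma> x) is at least exp (- |\<gamma>| b). A transform
  that is finite at one argument thus gives integrability near 0; with \<gamma> = 1/b the same
  inequality is a Chernoff bound for the mass on (0,b).\<close>

lemma nn_integral_le_laplace:
  assumes [measurable]: "f \<in> borel_measurable borel"
  shows "(\<integral>\<^sup>+x. (if 0 < x \<and> x < b then f x else 0) \<partial>lborel) \<le> ennreal (exp (\<bar>\<gamma>\<bar> * b)) * laplace f \<gamma>"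
proof -
  have "(\<integral>\<^sup>+x. (if 0 < x \<and> x < b then f x else 0) \<partial>lborel)
    \<le> (\<integral>\<^sup>+x. ennreal (exp (\<bar>\<gamma>\<bar> * b)) * (ennreal (exp (- \<gamma> * x)) * f x * indicator {0<..} x) \<partial>lborel)"
  proof (intro nn_integral_mono)
    fix x :: real
    show "(if 0 < x \<and> x < b then f x else 0)
      \<le> ennreal (exp (\<bar>\<gamma>\<bar> * b)) * (ennreal (exp (- \<gamma> * x)) * f x * indicator {0<..} x)"
    proof (cases "0 < x \<and> x < b")
      case True
      have "\<gamma> * x \<le> \<bar>\<gamma>\<bar> * b"
        using True by (intro mult_mono) auto
      then have "1 \<le> exp (\<bar>\<gamma>\<bar> * b) * exp (- \<gamma> * x)"
        by (simp add: exp_add[symmetric])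
      then have "1 * f x \<le> ennreal (exp (\<bar>\<gamma>\<bar> * b) * exp (- \<gamma> * x)) * f x"
        by (intro mult_right_mono) (auto simp flip: ennreal_1 intro: ennreal_leI)
      with True show ?thesis
        by (simp add: ennreal_mult mult.assoc)
    qed auto
  qed
  also have "\<dots> = ennreal (exp (\<bar>\<gamma>\<bar> * b)) * laplace f \<gamma>"
    unfolding laplace_def by (rule nn_integral_cmult) measurable
  finally show ?thesis .
qed

text \<open>Cutting at x/2 separates the singularities at 0: for y < x/2 the argument x - y stays
  away from 0, so only the integrability of \<open>g\<close> near 0 is at stake. The other half is
  the same expression with the roles exchanged.\<close>

definition half_conv :: "(real \<Rightarrow> ennreal) \<Rightarrow> (real \<Rightarrow> ennreal) \<Rightarrow> real \<Rightarrow> ennreal" where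
  "half_conv f g x = (\<integral>\<^sup>+y. (if 0 < y \<and> y < x / 2 then f (x - y) * g y else 0) \<partial>lborel)"

lemma conv_eq_half_conv:
  assumes [measurable]: "f \<in> borel_measurable borel" "g \<in> borel_measurable borel"
  shows "conv f g x = half_conv f g x + half_conv g f x"
proof -
  have half: "half_conv g f x = (\<integral>\<^sup>+y. (if x / 2 < y \<and> y < x then f (x - y) * g y else 0) \<partial>lborel)"
    unfolding half_conv_def
    by (subst nn_integral_real_affine[where c="-1" and t=x])
      (auto intro!: nn_integral_cong simp: mult.commute)
  have "half_conv f g x + half_conv g f x = (\<integral>\<^sup>+y. (if 0 < y \<and> y < x / 2 then f (x - y) * g y else 0)
      + (if x / 2 < y \<and> y < x then f (x - y) * g y else 0) \<partial>lborel)"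
    unfolding half unfolding half_conv_def by (rule nn_integral_add[symmetric]) measurable
  also have "\<dots> = conv f g x"
    unfolding conv_def
  proof (intro nn_integral_cong_AE)
    show "AE y in lborel. (if 0 < y \<and> y < x / 2 then f (x - y) * g y else 0)
      + (if x / 2 < y \<and> y < x then f (x - y) * g y else 0) = (if 0 < y \<and> y < x then f (x - y) * g y else 0)"
      using AE_lborel_singleton[of "x / 2"] by eventually_elim auto
  qed
  finally show ?thesis by simp
qed

text \<open>For x in [a,b] and y < x/2, the point x - y lies in the compact interval [a/2,b], where
  \<open>f\<close> has a finite maximum m. Then m g on (0,b) is an integrable majorant independent
  of x, and dominated convergence gives continuity.\<close>

lemma half_conv_bound:
  assumes f[measurable]: "f \<in> borel_measurable borel" and g[measurable]: "g \<in> borel_measurable borel"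
    and cont: "continuous_on {0<..} f" and fin: "\<And>x. 0 < x \<Longrightarrow> f x < \<infinity>"
    and lap: "laplace g \<gamma> < \<infinity>"
    and ab: "0 < a" "a \<le> b"
  shows "continuous_on {a..b} (half_conv f g)" "x \<in> {a..b} \<Longrightarrow> half_conv f g x < \<infinity>"
proof -
  have "continuous_on {a / 2..b} f"
    by (rule continuous_on_subset[OF cont]) (use ab in auto)
  moreover have "{a / 2..b} \<noteq> {}"
    using ab by auto
  ultimately obtain z where z: "z \<in> {a / 2..b}" "\<And>y. y \<in> {a / 2..b} \<Longrightarrow> f y \<le> f z"
    using continuous_attains_sup[of "{a / 2..b}" f] compact_Icc by blast
  define m where "m = f z"
  have m: "m < \<infinity>"
    using z(1) ab unfolding m_def by (intro fin) auto
  define w where "w y = m * (if 0 < y \<and> y < b then g y else 0)" for y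
  have [measurable]: "w \<in> borel_measurable borel"
    unfolding w_def by measurable
  have w: "(\<integral>\<^sup>+y. w y \<partial>lborel) < \<infinity>"
  proof -
    have "(\<integral>\<^sup>+y. w y \<partial>lborel) = m * (\<integral>\<^sup>+y. (if 0 < y \<and> y < b then g y else 0) \<partial>lborel)"
      unfolding w_def by (rule nn_integral_cmult) measurable
    also have "\<dots> \<le> m * (ennreal (exp (\<bar>\<gamma>\<bar> * b)) * laplace g \<gamma>)"
      by (intro mult_left_mono nn_integral_le_laplace) auto
    also have "\<dots> < \<infinity>"
      using m lap by (auto simp: ennreal_mult_less_top)
    finally show ?thesis .
  qed
  have le: "(if 0 < y \<and> y < x / 2 then f (x - y) * g y else 0) \<le> w y" if "x \<in> {a..b}" for x y
    using that ab z(2)[of "x - y"] unfolding w_def m_def by (auto intro!: mult_right_mono)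
  show "half_conv f g x < \<infinity>" if "x \<in> {a..b}" for x
    unfolding half_conv_def by (rule le_less_trans[OF nn_integral_mono w]) (rule le[OF that])
  \<comment> \<open>Multiplication by \<open>g y\<close> preserves limits in \<open>ennreal\<close>
    when \<open>g y\<close> is finite; integrability on (0,b) supplies this almost
    everywhere.\<close>
  have "AE y in lborel. 0 < y \<and> y < b \<longrightarrow> g y < \<infinity>"
  proof -
    have "AE y in lborel. (if 0 < y \<and> y < b then g y else 0) \<noteq> \<infinity>"
    proof (rule nn_integral_PInf_AE)
      have "(\<integral>\<^sup>+y. (if 0 < y \<and> y < b then g y else 0) \<partial>lborel) \<le> ennreal (exp (\<bar>\<gamma>\<bar> * b)) * laplace g \<gamma>"
        by (rule nn_integral_le_laplace) measurable
      also have "\<dots> < \<infinity>"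
        using lap by (auto simp: ennreal_mult_less_top)
      finally show "(\<integral>\<^sup>+y. (if 0 < y \<and> y < b then g y else 0) \<partial>lborel) \<noteq> \<infinity>"
        by auto
    qed measurable
    then show ?thesis
      by eventually_elim (auto simp: less_top split: if_splits)
  qed
  note gfin = this
  show "continuous_on {a..b} (half_conv f g)"
    unfolding continuous_on_sequentially comp_def
  proof safe
    fix u :: "nat \<Rightarrow> real" and x
    assume x: "x \<in> {a..b}" and u: "\<forall>n. u n \<in> {a..b}" "u \<longlonglongrightarrow> x"
    show "(\<lambda>n. half_conv f g (u n)) \<longlonglongrightarrow> half_conv f g x"
      unfolding half_conv_def
    proof (rule nn_integral_dominated_convergence[where w=w])
      show "AE y in lborel. (if 0 < y \<and> y < u n / 2 then f (u n - y) * g y else 0) \<le> w y" for n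
        using le u(1) by blast
      show "AE y in lborel. (\<lambda>n. if 0 < y \<and> y < u n / 2 then f (u n - y) * g y else 0)
        \<longlonglongrightarrow> (if 0 < y \<and> y < x / 2 then f (x - y) * g y else 0)"
        \<comment> \<open>At y = x/2 the condition y < u n / 2 may switch infinitely often along the
          sequence; this one point is discarded as a null set.\<close>
        using AE_lborel_singleton[of "x / 2"] gfin
      proof eventually_elim
        case (elim y)
        consider "y \<le> 0" | "0 < y" "y < x / 2" | "0 < y" "x / 2 < y"
          using elim(1) by linarith
        then show ?case
        proof cases
          case 2
          have "eventually (\<lambda>n. 2 * y < u n) sequentially"
            using u(2) 2 by (intro order_tendstoD) auto
          then have ev: "\<forall>\<^sub>F n in sequentially. g y * f (u n - y) =
            (if 0 < y \<and> y < u n / 2 then f (u n - y) * g y else 0)"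
            by eventually_elim (use 2 in \<open>auto simp: mult.commute\<close>)
          have "isCont f (x - y)"
            using cont 2 by (simp add: continuous_on_eq_continuous_at)
          moreover have "(\<lambda>n. u n - y) \<longlonglongrightarrow> x - y"
            using u(2) by (intro tendsto_intros)
          ultimately have "(\<lambda>n. f (u n - y)) \<longlonglongrightarrow> f (x - y)"
            by (rule isCont_tendsto_compose)
          then have "(\<lambda>n. g y * f (u n - y)) \<longlonglongrightarrow> g y * f (x - y)"
            using elim(2) 2 x by (intro ennreal_tendsto_cmult) auto
          from Lim_transform_eventually[OF this ev] show ?thesis
            using 2 by (simp add: mult.commute)
        next
          case 3
          have "eventually (\<lambda>n. u n < 2 * y) sequentially"
            using u(2) 3 by (intro order_tendstoD) auto
          then have ev: "\<forall>\<^sub>F n in sequentially. 0 =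
            (if 0 < y \<and> y < u n / 2 then f (u n - y) * g y else 0)"
            by eventually_elim (use 3 in auto)
          from Lim_transform_eventually[OF tendsto_const this] show ?thesis
            using 3 by simp
        qed auto
      qed
    qed (use w in \<open>auto\<close>)
  qed
qed

lemma conv_regular:
  assumes f[measurable]: "f \<in> borel_measurable borel" and g[measurable]: "g \<in> borel_measurable borel"
    and cont: "continuous_on {0<..} f" "continuous_on {0<..} g"
    and fin: "\<And>x. 0 < x \<Longrightarrow> f x < \<infinity>" "\<And>x. 0 < x \<Longrightarrow> g x < \<infinity>"
    and lap: "laplace f \<gamma> < \<infinity>" "laplace g \<gamma> < \<infinity>"
  shows "continuous_on {0<..} (conv f g)" "0 < x \<Longrightarrow> conv f g x < \<infinity>"
proof -
  show "conv f g x < \<infinity>" if "0 < x" for x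
    using half_conv_bound(2)[of f g _ x x x] half_conv_bound(2)[of g f _ x x x] assms that
    by (simp add: conv_eq_half_conv[OF f g])
  have "continuous (at x) (conv f g)" if "0 < x" for x
  proof -
    have "continuous_on {x / 2..2 * x} (\<lambda>x. half_conv f g x + half_conv g f x)"
      using assms that by (intro continuous_on_add_ennreal half_conv_bound(1)) auto
    then have "continuous_on {x / 2..2 * x} (conv f g)"
      by (simp add: conv_eq_half_conv[OF f g])
    then show ?thesis
      by (rule continuous_on_interior) (use that in auto)
  qed
  then show "continuous_on {0<..} (conv f g)"
    by (simp add: continuous_at_imp_continuous_on)
qed

section \<open>Differentiating a Laplace transform\<close>

lemma DERIV_imp_LIMSEQ:
  fixes f :: "real \<Rightarrow> real"
  assumes "(f has_real_derivative D) (at x)"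
  shows "(\<lambda>n. (f (x + inverse (real (Suc n))) - f x) * real (Suc n)) \<longlonglongrightarrow> D"
proof -
  have "filterlim (\<lambda>n. inverse (real (Suc n))) (at 0) sequentially"
    by (intro filterlim_atI LIMSEQ_inverse_real_of_nat) auto
  from filterlim_compose[OF assms[unfolded DERIV_def] this] show ?thesis
    by (simp add: divide_inverse)
qed

text \<open>
  The difference quotients \<open>(1 - exp (- \<epsilon> x)) / \<epsilon>\<close> are at most \<open>x\<close> and converge
  to \<open>x\<close>, so Fatou's lemma gives one inequality and monotonicity the other.
\<close>

lemma laplace_times_ident:
  assumes [measurable]: "f \<in> borel_measurable borel"
    and L: "\<And>\<gamma>. \<gamma>\<^sub>0 < \<gamma> \<Longrightarrow> laplace f \<gamma> = ennreal (L \<gamma>)" "\<And>\<gamma>. \<gamma>\<^sub>0 < \<gamma> \<Longrightarrow> 0 \<le> L \<gamma>"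
    and D: "(L has_real_derivative - D) (at \<gamma>)" and \<gamma>: "\<gamma>\<^sub>0 < \<gamma>"
  shows "laplace (\<lambda>x. ennreal x * f x) \<gamma> = ennreal D"
proof -
  define q where "q n x = (1 - exp (- x * inverse (real (Suc n)))) * real (Suc n)" for n :: nat and x :: real
  define u where "u n x = ennreal (exp (- \<gamma> * x)) * (ennreal (q n x) * f x) * indicator {0<..} x" for n x
  have [measurable]: "u n \<in> borel_measurable borel" for n
    unfolding u_def q_def by measurable
  have q_le: "0 \<le> q n x" "q n x \<le> x" if "0 < x" for n x
  proof -
    show "0 \<le> q n x"
      using that by (auto simp: q_def)
    have "1 + (- x * inverse (real (Suc n))) \<le> exp (- x * inverse (real (Suc n)))"
      by (rule exp_ge_add_one_self)
    then have "1 - exp (- x * inverse (real (Suc n))) \<le> x * inverse (real (Suc n))"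
      by simp
    then have "q n x \<le> x * inverse (real (Suc n)) * real (Suc n)"
      unfolding q_def by (intro mult_right_mono) auto
    then show "q n x \<le> x"
      by (simp only: mult.assoc) simp
  qed
  have q_lim: "(\<lambda>n. q n x) \<longlonglongrightarrow> x" for x
  proof -
    have "((\<lambda>e. - exp (- x * e)) has_real_derivative x) (at 0)"
      by (auto intro!: derivative_eq_intros)
    from DERIV_imp_LIMSEQ[OF this] show ?thesis
      by (simp add: q_def)
  qed
  \<comment> \<open>The identity is first proved as a sum with the transform at the larger argument,
    since subtraction in \<open>ennreal\<close> is safe only after both terms are known to be
    finite.\<close>
  have int_u: "(\<integral>\<^sup>+x. u n x \<partial>lborel) = ennreal ((L \<gamma> - L (\<gamma> + inverse (real (Suc n)))) * real (Suc n))" for n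
  proof -
    let ?\<gamma>' = "\<gamma> + inverse (real (Suc n))"
    have \<gamma>': "\<gamma>\<^sub>0 < ?\<gamma>'" "\<gamma> \<le> ?\<gamma>'"
      using \<gamma> inverse_positive_iff_positive[of "real (Suc n)"] by linarith+
    have "(\<integral>\<^sup>+x. u n x \<partial>lborel) + ennreal (real (Suc n)) * laplace f ?\<gamma>' =
      (\<integral>\<^sup>+x. u n x + ennreal (real (Suc n)) * (ennreal (exp (- ?\<gamma>' * x)) * f x * indicator {0<..} x) \<partial>lborel)"
      unfolding laplace_def by (subst nn_integral_add) (auto simp: nn_integral_cmult)
    also have "\<dots> = (\<integral>\<^sup>+x. ennreal (real (Suc n)) * (ennreal (exp (- \<gamma> * x)) * f x * indicator {0<..} x) \<partial>lborel)"
    proof (intro nn_integral_cong)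
      fix x :: real
      have "exp (- \<gamma> * x) * q n x + real (Suc n) * exp (- ?\<gamma>' * x) = real (Suc n) * exp (- \<gamma> * x)"
        unfolding q_def by (simp add: algebra_simps exp_add[symmetric])
      then have "ennreal (exp (- \<gamma> * x)) * ennreal (q n x) + ennreal (real (Suc n)) * ennreal (exp (- ?\<gamma>' * x))
        = ennreal (real (Suc n)) * ennreal (exp (- \<gamma> * x))" if "0 < x"
        using q_le(1)[OF that, of n] by (simp add: ennreal_mult[symmetric] ennreal_plus[symmetric] del: ennreal_plus)
      then have "(ennreal (exp (- \<gamma> * x)) * ennreal (q n x) + ennreal (real (Suc n)) * ennreal (exp (- ?\<gamma>' * x))) * f x
        = ennreal (real (Suc n)) * ennreal (exp (- \<gamma> * x)) * f x" if "0 < x"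
        using that by simp
      then show "u n x + ennreal (real (Suc n)) * (ennreal (exp (- ?\<gamma>' * x)) * f x * indicator {0<..} x)
        = ennreal (real (Suc n)) * (ennreal (exp (- \<gamma> * x)) * f x * indicator {0<..} x)"
        unfolding u_def by (cases "0 < x") (simp_all add: distrib_right mult.assoc)
    qed
    also have "\<dots> = ennreal (real (Suc n)) * laplace f \<gamma>"
      unfolding laplace_def by (rule nn_integral_cmult) measurable
    finally have eq: "(\<integral>\<^sup>+x. u n x \<partial>lborel) + ennreal (real (Suc n) * L ?\<gamma>') = ennreal (real (Suc n) * L \<gamma>)"
      using L \<gamma> \<gamma>' by (simp add: ennreal_mult)
    have "(\<integral>\<^sup>+x. u n x \<partial>lborel) =
      ((\<integral>\<^sup>+x. u n x \<partial>lborel) + ennreal (real (Suc n) * L ?\<gamma>')) - ennreal (real (Suc n) * L ?\<gamma>')"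
      by simp
    also have "\<dots> = ennreal (real (Suc n) * L \<gamma> - real (Suc n) * L ?\<gamma>')"
      unfolding eq using L(2)[OF \<gamma>'(1)] by (subst ennreal_minus) auto
    finally show ?thesis
      by (simp add: algebra_simps)
  qed
  have "(\<lambda>n. (L (\<gamma> + inverse (real (Suc n))) - L \<gamma>) * real (Suc n)) \<longlonglongrightarrow> - D"
    by (rule DERIV_imp_LIMSEQ[OF D])
  from tendsto_minus[OF this]
  have "(\<lambda>n. (L \<gamma> - L (\<gamma> + inverse (real (Suc n)))) * real (Suc n)) \<longlonglongrightarrow> D"
    by (simp add: algebra_simps)
  then have lim: "(\<lambda>n. \<integral>\<^sup>+x. u n x \<partial>lborel) \<longlonglongrightarrow> ennreal D"
    unfolding int_u by (rule tendsto_ennrealI)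
  show ?thesis
  proof (rule antisym)
    have "laplace (\<lambda>x. ennreal x * f x) \<gamma> \<le> (\<integral>\<^sup>+x. liminf (\<lambda>n. u n x) \<partial>lborel)"
      unfolding laplace_def
    proof (intro nn_integral_mono)
      fix x :: real
      show "ennreal (exp (- \<gamma> * x)) * (ennreal x * f x) * indicator {0<..} x \<le> liminf (\<lambda>n. u n x)"
      proof (cases "0 < x")
        case True
        have "(\<lambda>n. ennreal (q n x) * (ennreal (exp (- \<gamma> * x)) * f x)) \<longlonglongrightarrow>
          ennreal x * (ennreal (exp (- \<gamma> * x)) * f x)"
          using True by (intro tendsto_mult_ennreal tendsto_ennrealI q_lim tendsto_const) (auto simp: ennreal_eq_0_iff)
        then have "(\<lambda>n. u n x) \<longlonglongrightarrow> ennreal x * (ennreal (exp (- \<gamma> * x)) * f x)"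
          using True by (simp add: u_def ac_simps)
        from lim_imp_Liminf[OF _ this] show ?thesis
          using True by (simp add: ac_simps)
      qed auto
    qed
    also have "\<dots> \<le> liminf (\<lambda>n. \<integral>\<^sup>+x. u n x \<partial>lborel)"
      by (rule nn_integral_liminf) simp
    also have "\<dots> = ennreal D"
      by (rule lim_imp_Liminf[OF _ lim]) simp
    finally show "laplace (\<lambda>x. ennreal x * f x) \<gamma> \<le> ennreal D" .
    show "ennreal D \<le> laplace (\<lambda>x. ennreal x * f x) \<gamma>"
    proof (rule LIMSEQ_le_const2[OF lim], intro exI allI impI)
      fix n
      show "(\<integral>\<^sup>+x. u n x \<partial>lborel) \<le> laplace (\<lambda>x. ennreal x * f x) \<gamma>"
        unfolding laplace_def u_def
        by (intro nn_integral_mono)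
          (auto simp: indicator_def q_le intro!: mult_left_mono mult_right_mono ennreal_leI)
    qed
  qed
qed

section \<open>Riemann-Liouville kernels\<close>

definition rl_kernel :: "real \<Rightarrow> real \<Rightarrow> ennreal" where
  "rl_kernel a u = ennreal (u powr (a - 1) / Gamma a)"

lemma borel_measurable_rl_kernel [measurable]: "rl_kernel a \<in> borel_measurable borel"
  unfolding rl_kernel_def by measurable

lemma continuous_on_rl_kernel: "continuous_on {0<..} (rl_kernel a)"
  unfolding rl_kernel_def divide_inverse
  by (intro continuous_on_ennreal continuous_intros) auto

text \<open>This is the Gamma integral after the scaling t = \<gamma> x. The kernels serve twice: in
  x they build the size-biasing kernels and the Mittag-Leffler series, in t they are the weights 1
  (order 1) and t (order 2).\<close>

lemma laplace_rl_kernel: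
  assumes a: "0 < a" and \<gamma>: "0 < \<gamma>"
  shows "laplace (rl_kernel a) \<gamma> = ennreal (\<gamma> powr (- a))"
proof -
  have G: "0 < Gamma a"
    using a by (rule Gamma_real_pos)
  have "ennreal (Gamma a) = (\<integral>\<^sup>+t. ennreal (indicator {0..} t * t powr (a - 1) / exp t) \<partial>lborel)"
    by (rule Gamma_conv_nn_integral_real[OF a])
  also have "\<dots> = ennreal \<gamma> * (\<integral>\<^sup>+x. ennreal (indicator {0..} (\<gamma> * x) * (\<gamma> * x) powr (a - 1) / exp (\<gamma> * x)) \<partial>lborel)"
    using \<gamma> by (subst nn_integral_real_affine[where c=\<gamma> and t=0]) auto
  also have "(\<integral>\<^sup>+x. ennreal (indicator {0..} (\<gamma> * x) * (\<gamma> * x) powr (a - 1) / exp (\<gamma> * x)) \<partial>lborel)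
    = (\<integral>\<^sup>+x. ennreal (\<gamma> powr (a - 1) * Gamma a) * (ennreal (exp (- \<gamma> * x)) * rl_kernel a x * indicator {0<..} x) \<partial>lborel)"
  proof (intro nn_integral_cong)
    fix x :: real
    show "ennreal (indicator {0..} (\<gamma> * x) * (\<gamma> * x) powr (a - 1) / exp (\<gamma> * x)) =
      ennreal (\<gamma> powr (a - 1) * Gamma a) * (ennreal (exp (- \<gamma> * x)) * rl_kernel a x * indicator {0<..} x)"
    proof (cases "0 < x")
      case True
      then show ?thesis
        using \<gamma> G by (simp add: rl_kernel_def ennreal_mult[symmetric] powr_mult exp_minus divide_inverse)
    next
      case False
      then have "x = 0 \<or> \<gamma> * x < 0"
        using \<gamma> by (auto simp: mult_pos_neg not_less order_le_less)
      then show ?thesis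
        using False by (auto simp: indicator_def)
    qed
  qed
  also have "\<dots> = ennreal (\<gamma> powr (a - 1) * Gamma a) * laplace (rl_kernel a) \<gamma>"
    unfolding laplace_def by (rule nn_integral_cmult) measurable
  finally have "ennreal (Gamma a) = ennreal (\<gamma> * (\<gamma> powr (a - 1) * Gamma a)) * laplace (rl_kernel a) \<gamma>"
    using \<gamma> G by (simp add: ennreal_mult mult.assoc)
  moreover have "\<gamma> * (\<gamma> powr (a - 1) * Gamma a) = \<gamma> powr a * Gamma a"
    using \<gamma> powr_mult_base[of \<gamma> "a - 1"] by simp
  ultimately have "ennreal (\<gamma> powr (- a) / Gamma a) * ennreal (Gamma a) =
      (ennreal (\<gamma> powr (- a) / Gamma a) * ennreal (\<gamma> powr a * Gamma a)) * laplace (rl_kernel a) \<gamma>"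
    by (simp add: mult.assoc)
  then show ?thesis
    using \<gamma> G by (simp add: ennreal_mult[symmetric] powr_minus field_simps del: ennreal_mult)
qed

lemma has_bochner_integral_rl_kernel:
  fixes a \<gamma> :: real
  assumes a: "0 < a" and \<gamma>: "0 < \<gamma>"
  shows "has_bochner_integral lborel (\<lambda>x. exp (- \<gamma> * x) * (x powr (a - 1) / Gamma a) * indicator {0<..} x) (\<gamma> powr (- a))"
proof -
  have G: "0 < Gamma a"
    using a by (rule Gamma_real_pos)
  have "(\<integral>\<^sup>+x. ennreal (exp (- \<gamma> * x) * (x powr (a - 1) / Gamma a) * indicator {0<..} x) \<partial>lborel)
    = laplace (rl_kernel a) \<gamma>"
    unfolding laplace_def rl_kernel_def using G
    by (intro nn_integral_cong) (auto simp: ennreal_mult[symmetric] indicator_def)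
  then show ?thesis
    using laplace_rl_kernel[OF assms] G
    by (intro has_bochner_integral_nn_integral) (auto simp: indicator_def)
qed

section \<open>Mittag-Leffler functions\<close>

text \<open>Only the part of the Gamma integral over [T, T + 1] is kept. As T is arbitrary, Gamma
  outgrows every geometric sequence, which is all that convergence of the Mittag-Leffler series
  requires.\<close>

lemma Gamma_real_lower_bound:
  fixes p T :: real
  assumes p: "1 \<le> p" and T: "1 \<le> T"
  shows "T powr (p - 1) * exp (- (T + 1)) \<le> Gamma p"
proof -
  have "ennreal (T powr (p - 1) * exp (- (T + 1))) =
    (\<integral>\<^sup>+t. ennreal (T powr (p - 1) * exp (- (T + 1))) * indicator {T..T + 1} t \<partial>lborel)"
    by (subst nn_integral_cmult) auto
  also have "\<dots> \<le> (\<integral>\<^sup>+t. ennreal (indicator {0..} t * t powr (p - 1) / exp t) \<partial>lborel)"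
  proof (intro nn_integral_mono)
    fix t :: real
    show "ennreal (T powr (p - 1) * exp (- (T + 1))) * indicator {T..T + 1} t
      \<le> ennreal (indicator {0..} t * t powr (p - 1) / exp t)"
    proof (cases "t \<in> {T..T + 1}")
      case True
      have "T powr (p - 1) * exp (- (T + 1)) \<le> t powr (p - 1) * exp (- t)"
        using True p T by (intro mult_mono powr_mono2) auto
      with True T show ?thesis
        by (simp add: ennreal_leI exp_minus divide_inverse)
    qed auto
  qed
  also have "\<dots> = ennreal (Gamma p)"
    using p by (intro Gamma_conv_nn_integral_real[symmetric]) auto
  finally show ?thesis
    using p by (subst (asm) ennreal_le_iff) (auto intro: Gamma_real_nonneg)
qed

lemma summable_mittag_leffler:
  fixes \<nu> \<psi> z :: real
  assumes \<nu>: "0 < \<nu>" and \<psi>: "0 < \<psi>"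
  shows "summable (\<lambda>k. z ^ k / Gamma (\<nu> * real k + \<psi>))"
proof -
  \<comment> \<open>With T^\<nu> at least 2 |z|, the lower bound on Gamma makes the series
    comparable to a geometric one of ratio 1/2.\<close>
  define T where "T = max 1 ((2 * \<bar>z\<bar>) powr (1 / \<nu>))"
  have T: "1 \<le> T"
    by (simp add: T_def)
  have "2 * \<bar>z\<bar> = ((2 * \<bar>z\<bar>) powr (1 / \<nu>)) powr \<nu>"
    using \<nu> by (simp add: powr_powr)
  also have "\<dots> \<le> T powr \<nu>"
    unfolding T_def using \<nu> by (intro powr_mono2) auto
  finally have z: "\<bar>z\<bar> * T powr (- \<nu>) \<le> 1 / 2"
    using T by (simp add: powr_minus field_simps)
  define C where "C = exp (T + 1) * T powr (1 - \<psi>)"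
  \<comment> \<open>The Gamma bound requires an argument of at least 1, which holds once \<nu> k
    \<ge> 1.\<close>
  have "eventually (\<lambda>k. 1 / \<nu> \<le> real k) sequentially"
    by real_asymp
  then have "eventually (\<lambda>k. norm (z ^ k / Gamma (\<nu> * real k + \<psi>)) \<le> C * (1 / 2) ^ k) sequentially"
  proof eventually_elim
    case (elim k)
    define p where "p = \<nu> * real k + \<psi>"
    have p: "1 \<le> p"
      using elim \<nu> \<psi> by (simp add: p_def field_simps)
    have G: "0 < Gamma p"
      using p by (intro Gamma_real_pos) auto
    have "1 / Gamma p \<le> 1 / (T powr (p - 1) * exp (- (T + 1)))"
      using G T by (intro divide_left_mono Gamma_real_lower_bound p) auto
    also have "\<dots> = exp (T + 1) * T powr (1 - p)"
      using T exp_minus[of "T + 1"] powr_minus[of T "p - 1"] by (simp add: divide_inverse mult.commute)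
    also have "T powr (1 - p) = T powr (1 - \<psi>) * (T powr (- \<nu>)) ^ k"
      using T by (simp add: p_def powr_powr powr_add[symmetric] powr_realpow[symmetric] algebra_simps)
    finally have "1 / Gamma p \<le> C * (T powr (- \<nu>)) ^ k"
      by (simp add: C_def)
    then have "\<bar>z\<bar> ^ k * (1 / Gamma p) \<le> \<bar>z\<bar> ^ k * (C * (T powr (- \<nu>)) ^ k)"
      by (intro mult_left_mono) auto
    also have "\<dots> = C * (\<bar>z\<bar> * T powr (- \<nu>)) ^ k"
      by (simp add: power_mult_distrib)
    also have "\<dots> \<le> C * (1 / 2) ^ k"
      using z by (intro mult_left_mono power_mono) (auto simp: C_def)
    finally show ?case
      using G by (simp add: p_def power_abs)
  qed
  then show ?thesis
    by (rule summable_comparison_test_ev) (auto intro!: summable_mult summable_geometric)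
qed

lemma isCont_mittag_leffler:
  fixes \<nu> \<psi> z :: real
  assumes "0 < \<nu>" "0 < \<psi>"
  shows "isCont (mittag_leffler \<nu> \<psi>) z"
proof -
  have "((\<lambda>z. \<Sum>k. 1 / Gamma (\<nu> * real k + \<psi>) * z ^ k) has_field_derivative
    (\<Sum>k. diffs (\<lambda>k. 1 / Gamma (\<nu> * real k + \<psi>)) k * z ^ k)) (at z)"
    by (rule termdiffs_strong_converges_everywhere) (use summable_mittag_leffler[OF assms] in simp)
  then show ?thesis
    by (auto simp: mittag_leffler_def[abs_def] intro: DERIV_isCont)
qed

text \<open>Termwise differentiation produces the factor k + 1, which cancels against Gamma (\<nu>
  (k+1) + 1) = \<nu> (k+1) Gamma (\<nu> k + \<nu>) and leaves the series of order (\<nu>, \<nu>)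
  divided by \<nu>.\<close>

lemma has_field_derivative_mittag_leffler:
  fixes \<nu> z :: real
  assumes \<nu>: "0 < \<nu>"
  shows "(mittag_leffler \<nu> 1 has_real_derivative mittag_leffler \<nu> \<nu> z / \<nu>) (at z)"
proof -
  have "((\<lambda>z. \<Sum>k. 1 / Gamma (\<nu> * real k + 1) * z ^ k) has_field_derivative
    (\<Sum>k. diffs (\<lambda>k. 1 / Gamma (\<nu> * real k + 1)) k * z ^ k)) (at z)"
    by (rule termdiffs_strong_converges_everywhere) (use summable_mittag_leffler[OF \<nu>, of 1] in simp)
  moreover have "diffs (\<lambda>k. 1 / Gamma (\<nu> * real k + 1)) k * z ^ k =
      (z ^ k / Gamma (\<nu> * real k + \<nu>)) / \<nu>" for k
  proof -
    have "0 < \<nu> * real (Suc k)"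
      using \<nu> by simp
    then have "Gamma (\<nu> * real (Suc k) + 1) = \<nu> * real (Suc k) * Gamma (\<nu> * real (Suc k))"
      by (intro Gamma_plus1) (auto elim!: nonpos_Ints_cases)
    moreover have "\<nu> * real (Suc k) = \<nu> * real k + \<nu>"
      by (simp add: algebra_simps)
    ultimately show ?thesis
      using \<nu> by (simp add: diffs_def divide_simps) (simp add: algebra_simps)
  qed
  ultimately show ?thesis
    using suminf_divide[OF summable_mittag_leffler[OF \<nu> \<nu>, of z], of \<nu>]
    by (simp add: mittag_leffler_def[abs_def])
qed

text \<open>The factor \<nu> from differentiating the power cancels the 1/\<nu> of the preceding
  derivative; division by \<open>r\<close> then links the two forms of the final formula.\<close>

lemma DERIV_mittag_leffler_powr:
  fixes \<nu> r x :: real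
  assumes \<nu>: "0 < \<nu>" and x: "0 < x"
  shows "((\<lambda>y. mittag_leffler \<nu> 1 (r * y powr \<nu>)) has_real_derivative
    r * (x powr (\<nu> - 1) * mittag_leffler \<nu> \<nu> (r * x powr \<nu>))) (at x)"
proof -
  have "((\<lambda>y. r * y powr \<nu>) has_real_derivative r * (\<nu> * x powr (\<nu> - 1))) (at x)"
    using x by (auto intro!: derivative_eq_intros simp: powr_diff)
  from DERIV_chain2[OF has_field_derivative_mittag_leffler[OF \<nu>] this] show ?thesis
    using \<nu> by (simp add: mult_ac)
qed

text \<open>Integrating term by term gives the geometric series of r^k \<gamma>^(- \<nu> k - \<nu>).
  As \<open>r\<close> may be negative, the interchange rests on absolute convergence, which is the
  condition |r| < \<gamma>^\<nu>.\<close>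

lemma has_bochner_integral_mittag_leffler:
  fixes \<nu> r \<gamma> :: real
  assumes \<nu>: "0 < \<nu>" and \<gamma>: "0 < \<gamma>" and r: "\<bar>r\<bar> < \<gamma> powr \<nu>"
  shows "has_bochner_integral lborel
    (\<lambda>x. exp (- \<gamma> * x) * (x powr (\<nu> - 1) * mittag_leffler \<nu> \<nu> (r * x powr \<nu>)) * indicator {0<..} x)
    (1 / (\<gamma> powr \<nu> - r))"
proof -
  define a where "a k = \<nu> * real k + \<nu>" for k
  have a: "0 < a k" for k
    using \<nu> by (simp add: a_def add_nonneg_pos)
  define t where "t k x = exp (- \<gamma> * x) * (x powr (a k - 1) / Gamma (a k)) * indicator {0<..} x" for k x
  define F where "F k x = r ^ k * t k x" for k x
  have t0: "0 \<le> t k x" for k x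
    using Gamma_real_pos[OF a[of k]] by (auto simp: t_def)
  have t: "has_bochner_integral lborel (t k) (\<gamma> powr (- a k))" for k
    unfolding t_def by (rule has_bochner_integral_rl_kernel[OF a \<gamma>])
  have F: "integrable lborel (F k)" "integral\<^sup>L lborel (F k) = r ^ k * \<gamma> powr (- a k)" for k
    using has_bochner_integral_mult_right[OF t[of k], of "r ^ k"]
    unfolding F_def by (auto simp: has_bochner_integral_iff)
  have norm_F: "norm (F k x) = \<bar>r\<bar> ^ k * t k x" for k x
    using t0[of k x] by (simp add: F_def abs_mult power_abs)
  have nF: "(\<integral>x. norm (F k x) \<partial>lborel) = \<bar>r\<bar> ^ k * \<gamma> powr (- a k)" for k
    using has_bochner_integral_mult_right[OF t[of k], of "\<bar>r\<bar> ^ k"]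
    unfolding norm_F by (auto simp: has_bochner_integral_iff)
  have pw: "c ^ k * \<gamma> powr (- a k) = \<gamma> powr (- \<nu>) * (c * \<gamma> powr (- \<nu>)) ^ k" for c k
    using \<gamma> by (simp add: a_def powr_add[symmetric] power_mult_distrib powr_realpow[symmetric]
        powr_powr algebra_simps)
  have sums_F: "(\<Sum>k. F k x) = exp (- \<gamma> * x) * (x powr (\<nu> - 1) * mittag_leffler \<nu> \<nu> (r * x powr \<nu>)) * indicator {0<..} x"
    and summ_F: "summable (\<lambda>k. norm (F k x))" for x
  proof -
    define c where "c = exp (- \<gamma> * x) * x powr (\<nu> - 1) * indicator {0<..} x"
    have eq: "q ^ k * t k x = c * ((q * x powr \<nu>) ^ k / Gamma (\<nu> * real k + \<nu>))" for q k
    proof (cases "0 < x")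
      case True
      then have "x powr (a k - 1) = x powr (\<nu> - 1) * (x powr \<nu>) ^ k"
        by (simp add: a_def powr_add[symmetric] powr_realpow[symmetric] powr_powr algebra_simps)
      then show ?thesis
        by (simp add: t_def c_def power_mult_distrib a_def)
    qed (simp add: t_def c_def)
    have "norm (F k x) = c * ((\<bar>r\<bar> * x powr \<nu>) ^ k / Gamma (\<nu> * real k + \<nu>))" for k
      unfolding norm_F by (rule eq)
    then show "summable (\<lambda>k. norm (F k x))"
      by (simp only:) (intro summable_mult summable_mittag_leffler \<nu>)
    show "(\<Sum>k. F k x) = exp (- \<gamma> * x) * (x powr (\<nu> - 1) * mittag_leffler \<nu> \<nu> (r * x powr \<nu>)) * indicator {0<..} x"
      unfolding F_def eq
      by (subst suminf_mult[OF summable_mittag_leffler[OF \<nu> \<nu>]]) (simp add: mittag_leffler_def c_def)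
  qed
  have q: "\<bar>r * \<gamma> powr (- \<nu>)\<bar> < 1"
    using r \<gamma> by (simp add: powr_minus abs_mult field_simps)
  have "summable (\<lambda>k. \<integral>x. norm (F k x) \<partial>lborel)"
    unfolding nF pw using q by (intro summable_mult summable_geometric) (simp add: abs_mult)
  note swap = F(1) AE_I2[OF summ_F] this
  have "(\<integral>x. (\<Sum>k. F k x) \<partial>lborel) = (\<Sum>k. \<gamma> powr (- \<nu>) * (r * \<gamma> powr (- \<nu>)) ^ k)"
    by (simp only: integral_suminf[OF swap] F(2) pw)
  also have "\<dots> = \<gamma> powr (- \<nu>) * (1 / (1 - r * \<gamma> powr (- \<nu>)))"
    using q by (subst suminf_mult) (auto simp: suminf_geometric)
  also have "\<dots> = 1 / (\<gamma> powr \<nu> - r)"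
    using \<gamma> r by (simp add: powr_minus field_simps)
  finally have "has_bochner_integral lborel (\<lambda>x. \<Sum>k. F k x) (1 / (\<gamma> powr \<nu> - r))"
    using integrable_suminf[OF swap] by (simp add: has_bochner_integral_iff)
  then show ?thesis
    unfolding sums_F .
qed

section \<open>The law of a sum of independent stable subordinators\<close>

text \<open>If the values at x differed, disjoint neighbourhoods of them and continuity would make
  the functions differ on an interval around x, which has positive measure. The Hausdorff codomain
  covers both \<open>real\<close> and \<open>ennreal\<close>.\<close>

lemma AE_eq_imp_eq_on_open:
  fixes f g :: "real \<Rightarrow> 'b::t2_space"
  assumes "AE x in lborel. x \<in> S \<longrightarrow> f x = g x" and S: "open S"
    and "continuous_on S f" "continuous_on S g" and x: "x \<in> S"
  shows "f x = g x"
proof (rule ccontr)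
  assume "f x \<noteq> g x"
  then obtain U V where UV: "open U" "open V" "f x \<in> U" "g x \<in> V" "U \<inter> V = {}"
    using hausdorff by metis
  have "isCont f x" "isCont g x"
    using assms by (auto simp: continuous_on_eq_continuous_at)
  then have "eventually (\<lambda>y. f y \<in> U) (nhds x)" "eventually (\<lambda>y. g y \<in> V) (nhds x)"
    using UV unfolding isCont_def tendsto_at_iff_tendsto_nhds by (blast dest: topological_tendstoD)+
  moreover have "eventually (\<lambda>y. y \<in> S) (nhds x)"
    using S x by (rule eventually_nhds_in_open)
  ultimately have "eventually (\<lambda>y. y \<in> S \<and> f y \<noteq> g y) (nhds x)"
    by eventually_elim (use UV(5) in auto)
  then obtain e where e: "0 < e" "\<And>y. dist y x < e \<Longrightarrow> y \<in> S \<and> f y \<noteq> g y"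
    by (auto simp: eventually_nhds_metric)
  have "AE y in lborel. y \<notin> {x - e<..<x + e}"
    using assms(1) by eventually_elim (use e(2) in \<open>force simp: dist_real_def abs_less_iff\<close>)
  then have "emeasure lborel {x - e<..<x + e} = 0"
    by (subst (asm) AE_iff_measurable[where N="{x - e<..<x + e}"]) auto
  with e(1) show False
    by simp
qed

lemma tendsto_floor_approx:
  fixes x :: real
  assumes x: "0 < x"
  shows "(\<lambda>n. (real_of_int (max 0 \<lfloor>x * real (Suc n)\<rfloor>) + 1) / real (Suc n)) \<longlonglongrightarrow> x"
proof -
  have "(\<lambda>n. x + 1 / real (Suc n)) \<longlonglongrightarrow> x + 0"
    by (intro tendsto_add tendsto_const) (use LIMSEQ_inverse_real_of_nat in \<open>simp add: inverse_eq_divide\<close>)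
  then have up: "(\<lambda>n. x + 1 / real (Suc n)) \<longlonglongrightarrow> x"
    by simp
  have b: "x \<le> (real_of_int (max 0 \<lfloor>x * real (Suc n)\<rfloor>) + 1) / real (Suc n)"
    "(real_of_int (max 0 \<lfloor>x * real (Suc n)\<rfloor>) + 1) / real (Suc n) \<le> x + 1 / real (Suc n)" for n
  proof -
    have "0 \<le> \<lfloor>x * real (Suc n)\<rfloor>"
      using x by simp
    then have m: "max 0 \<lfloor>x * real (Suc n)\<rfloor> = \<lfloor>x * real (Suc n)\<rfloor>"
      by simp
    have "x * real (Suc n) \<le> real_of_int \<lfloor>x * real (Suc n)\<rfloor> + 1" "real_of_int \<lfloor>x * real (Suc n)\<rfloor> \<le> x * real (Suc n)"
      by linarith+
    then show "x \<le> (real_of_int (max 0 \<lfloor>x * real (Suc n)\<rfloor>) + 1) / real (Suc n)"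
      "(real_of_int (max 0 \<lfloor>x * real (Suc n)\<rfloor>) + 1) / real (Suc n) \<le> x + 1 / real (Suc n)"
      unfolding m by (simp_all add: field_simps del: of_nat_Suc)
  qed
  show ?thesis
    by (rule tendsto_sandwich[OF _ _ tendsto_const up]) (use b in auto)
qed

text \<open>The first argument is replaced by a grid point with one of countably many values, which
  keeps measurability, and continuity in x lets the mesh tend to 0. The \<open>max 0\<close> and the
  + 1 in the grid points keep them positive for every integer index, where the sections are known to
  be measurable.\<close>

lemma borel_measurable_caratheodory:
  fixes f :: "real \<Rightarrow> real \<Rightarrow> ennreal"
  assumes meas: "\<And>x. 0 < x \<Longrightarrow> f x \<in> borel_measurable borel"
    and cont: "\<And>t. continuous_on {0<..} (\<lambda>x. f x t)"
  shows "(\<lambda>p. if 0 < fst p then f (fst p) (snd p) else 0) \<in> borel_measurable (borel \<Otimes>\<^sub>M borel)"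
proof -
  define a where "a n i = (real_of_int (max 0 i) + 1) / real (Suc n)" for n :: nat and i :: int
  define F where "F n p = (if 0 < fst p then f (a n \<lfloor>fst p * real (Suc n)\<rfloor>) (snd p) else 0)"
    for n and p :: "real \<times> real"
  have a: "0 < a n i" for n i
    by (simp add: a_def add_nonneg_pos)
  have [measurable]: "F n \<in> borel_measurable (borel \<Otimes>\<^sub>M borel)" for n
  proof -
    have "(\<lambda>p. f (a n i) (snd p)) \<in> borel_measurable (borel \<Otimes>\<^sub>M borel)" for i
      using meas[OF a] by measurable
    then have "(\<lambda>p. f (a n \<lfloor>fst p * real (Suc n)\<rfloor>) (snd p)) \<in> borel_measurable (borel \<Otimes>\<^sub>M borel)"
      by (rule measurable_compose_countable[where f="\<lambda>i p. f (a n i) (snd p)"]) measurable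
    then show ?thesis
      unfolding F_def by measurable
  qed
  have "(\<lambda>n. F n p) \<longlonglongrightarrow> (if 0 < fst p then f (fst p) (snd p) else 0)" for p
  proof (cases "0 < fst p")
    case True
    have "isCont (\<lambda>x. f x (snd p)) (fst p)"
      using cont True by (simp add: continuous_on_eq_continuous_at)
    moreover have "(\<lambda>n. a n \<lfloor>fst p * real (Suc n)\<rfloor>) \<longlonglongrightarrow> fst p"
      unfolding a_def by (rule tendsto_floor_approx[OF True])
    ultimately show ?thesis
      unfolding F_def using True isCont_tendsto_compose by fastforce
  qed (simp add: F_def)
  then have "(\<lambda>p. if 0 < fst p then f (fst p) (snd p) else 0) = (\<lambda>p. liminf (\<lambda>n. F n p))"
    by (auto intro!: ext lim_imp_Liminf[symmetric])
  then show ?thesis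
    by simp
qed

section \<open>Transform and joint measurability of the density\<close>

lemma stable_subordinator_regular:
  assumes M: "prob_space M" and S: "stable_subordinator M \<alpha> H" and t: "0 < t" and \<gamma>: "0 < \<gamma>"
  shows "H t \<in> borel_measurable M"
    and "AE \<omega> in M. mono_on {0..} (\<lambda>t. H t \<omega>) \<and> H 0 \<omega> = 0"
    and "(\<integral>\<omega>. exp (- \<gamma> * H t \<omega>) \<partial>M) = exp (- t * \<gamma> powr \<alpha>)"
proof -
  interpret prob_space M by fact
  show "H t \<in> borel_measurable M"
    and "AE \<omega> in M. mono_on {0..} (\<lambda>t. H t \<omega>) \<and> H 0 \<omega> = 0"
    and "(\<integral>\<omega>. exp (- \<gamma> * H t \<omega>) \<partial>M) = exp (- t * \<gamma> powr \<alpha>)"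
    using S unfolding stable_subordinator_def
  proof (safe)
    assume *: "subordinator M H"
    then show "H t \<in> borel_measurable M"
      using t by (simp add: subordinator_def)
    have "AE \<omega> in M. H 0 \<omega> = 0"
      "AE \<omega> in M. mono_on {0..} (\<lambda>t. H t \<omega>) \<and> (\<forall>t\<ge>0. continuous (at_right t) (\<lambda>s. H s \<omega>))"
      using * unfolding subordinator_def by blast+
    then show "AE \<omega> in M. mono_on {0..} (\<lambda>t. H t \<omega>) \<and> H 0 \<omega> = 0"
      by eventually_elim blast
    assume "\<forall>t>0. \<forall>\<mu>>0. expectation (\<lambda>\<omega>. exp (- \<mu> * H t \<omega>)) = exp (- t * \<mu> powr \<alpha>)"
    then show "(\<integral>\<omega>. exp (- \<gamma> * H t \<omega>) \<partial>M) = exp (- t * \<gamma> powr \<alpha>)"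
      using t \<gamma> by blast
  next
    assume *: "\<forall>t\<ge>0. \<forall>\<omega>\<in>space M. H t \<omega> = t"
    then show "H t \<in> borel_measurable M"
      using t by (subst measurable_cong[where g="\<lambda>_. t"]) auto
    show "AE \<omega> in M. mono_on {0..} (\<lambda>t. H t \<omega>) \<and> H 0 \<omega> = 0"
      using * by (intro AE_I2) (auto intro!: mono_onI)
    have "(\<integral>\<omega>. exp (- \<gamma> * H t \<omega>) \<partial>M) = (\<integral>\<omega>. exp (- \<gamma> * t) \<partial>M)"
      using * t by (intro Bochner_Integration.integral_cong) auto
    then show "(\<integral>\<omega>. exp (- \<gamma> * H t \<omega>) \<partial>M) = exp (- t * \<gamma> powr 1)"
      using \<gamma> by (simp add: prob_space mult.commute)
  qed
qed

context
  fixes M :: "'a measure" and H1 H2 :: "real \<Rightarrow> 'a \<Rightarrow> real" and h :: "real \<Rightarrow> real \<Rightarrow> real"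
    and \<alpha> \<beta> c :: real and X :: "real \<Rightarrow> 'a \<Rightarrow> real"
  assumes M: "prob_space M"
    and S1: "stable_subordinator M \<alpha> H1" and S2: "stable_subordinator M \<beta> H2"
    and indep: "indep_processes M H1 H2"
    and X_def: "X = (\<lambda>t \<omega>. H1 t \<omega> + c * H2 t \<omega>)"
    and dens: "law_density M X h"
    and c: "0 < c"
begin

interpretation prob_space M by (rule M)

lemma law_densityD:
  assumes "0 < t"
  shows "0 \<le> h x t" "distributed M lborel (X t) (\<lambda>x. ennreal (h x t))"
    "continuous_on {0<..} (\<lambda>x. h x t)" "(\<lambda>x. ennreal (h x t)) \<in> borel_measurable borel"
    "X t \<in> borel_measurable M"
proof -
  show "0 \<le> h x t" and dist: "distributed M lborel (X t) (\<lambda>x. ennreal (h x t))"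
    and "continuous_on {0<..} (\<lambda>x. h x t)"
    using dens assms unfolding law_density_def by blast+
  show "(\<lambda>x. ennreal (h x t)) \<in> borel_measurable borel"
    using distributed_borel_measurable[OF dist] by simp
  show "X t \<in> borel_measurable M"
    using distributed_measurable[OF dist] by simp
qed

lemma sum_stable_mono: "AE \<omega> in M. mono_on {0..} (\<lambda>t. X t \<omega>) \<and> (\<forall>t\<ge>0. 0 \<le> H1 t \<omega> \<and> 0 \<le> H2 t \<omega>)"
  using stable_subordinator_regular(2)[OF M S1 zero_less_one zero_less_one]
    stable_subordinator_regular(2)[OF M S2 zero_less_one zero_less_one]
proof eventually_elim
  case (elim \<omega>)
  have "X s \<omega> \<le> X t \<omega>" if "0 \<le> s" "s \<le> t" for s t
  proof -
    have "H1 s \<omega> \<le> H1 t \<omega>" "H2 s \<omega> \<le> H2 t \<omega>"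
      using elim that mono_onD[of "{0..}" "\<lambda>t. H1 t \<omega>" s t] mono_onD[of "{0..}" "\<lambda>t. H2 t \<omega>" s t] by simp_all
    then show ?thesis
      using c unfolding X_def by (simp add: add_mono)
  qed
  then have "mono_on {0..} (\<lambda>t. X t \<omega>)"
    by (intro mono_onI) simp
  moreover have "0 \<le> H1 t \<omega>" "0 \<le> H2 t \<omega>" if "0 \<le> t" for t
    using elim that mono_onD[of "{0..}" "\<lambda>t. H1 t \<omega>" 0 t] mono_onD[of "{0..}" "\<lambda>t. H2 t \<omega>" 0 t] by simp_all
  ultimately show ?case
    by blast
qed

lemma laplace_law_density:
  assumes t: "0 < t" and \<gamma>: "0 < \<gamma>"
  shows "laplace (\<lambda>x. ennreal (h x t)) \<gamma> = ennreal (exp (- t * (\<gamma> powr \<alpha> + (c * \<gamma>) powr \<beta>)))"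
proof -
  note [measurable] = law_densityD(4,5)[OF t]
    stable_subordinator_regular(1)[OF M S1 t \<gamma>] stable_subordinator_regular(1)[OF M S2 t \<gamma>]
  \<comment> \<open>Independence is given for whole paths. Evaluation at time t is a measurable
    coordinate map on path space, so it passes to the two exponentials.\<close>
  have eval: "(\<lambda>f. f t) \<in> borel_measurable (Pi\<^sub>M {0..} (\<lambda>_. borel :: real measure))"
    using t by (intro measurable_component_singleton) simp
  have proj: "(\<lambda>f. exp (- b * f t)) \<in> borel_measurable (Pi\<^sub>M {0..} (\<lambda>_. borel))" for b :: real
    by (rule measurable_compose[OF eval, of "\<lambda>y. exp (- b * y)"]) measurable
  let ?E1 = "\<lambda>\<omega>. exp (- \<gamma> * H1 t \<omega>)" and ?E2 = "\<lambda>\<omega>. exp (- (c * \<gamma>) * H2 t \<omega>)"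
  have "indep_var borel ((\<lambda>f. exp (- \<gamma> * f t)) \<circ> (\<lambda>\<omega>. \<lambda>t\<in>{0..}. H1 t \<omega>))
    borel ((\<lambda>f. exp (- (c * \<gamma>) * f t)) \<circ> (\<lambda>\<omega>. \<lambda>t\<in>{0..}. H2 t \<omega>))"
    by (rule indep_var_compose[OF indep[unfolded indep_processes_def] proj proj])
  then have ind: "indep_var borel ?E1 borel ?E2"
    using t by (simp add: comp_def)
  have "AE \<omega> in M. norm (?E1 \<omega>) \<le> 1" "AE \<omega> in M. norm (?E2 \<omega>) \<le> 1"
    using sum_stable_mono by (eventually_elim, use c t \<gamma> in simp)+
  then have int: "integrable M ?E1" "integrable M ?E2"
    by (auto intro!: integrable_const_bound[where B=1])
  \<comment> \<open>Adding the null point 0 turns the half line into {0..}, which contains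
    \<open>X t\<close> almost surely; the indicator then disappears under the expectation.\<close>
  have "laplace (\<lambda>x. ennreal (h x t)) \<gamma> =
    (\<integral>\<^sup>+x. ennreal (h x t) * (ennreal (exp (- \<gamma> * x)) * indicator {0..} x) \<partial>lborel)"
    unfolding laplace_def
    using AE_lborel_singleton[of "0::real"]
    by (intro nn_integral_cong_AE) (auto elim!: eventually_mono simp: indicator_def mult_ac)
  also have "\<dots> = (\<integral>\<^sup>+\<omega>. ennreal (exp (- \<gamma> * X t \<omega>)) * indicator {0..} (X t \<omega>) \<partial>M)"
    by (rule distributed_nn_integral[OF law_densityD(2)[OF t]]) measurable
  also have "\<dots> = (\<integral>\<^sup>+\<omega>. ennreal (?E1 \<omega> * ?E2 \<omega>) \<partial>M)"
  proof (intro nn_integral_cong_AE)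
    show "AE \<omega> in M. ennreal (exp (- \<gamma> * X t \<omega>)) * indicator {0..} (X t \<omega>) = ennreal (?E1 \<omega> * ?E2 \<omega>)"
      using sum_stable_mono
    proof eventually_elim
      case (elim \<omega>)
      then have "0 \<le> X t \<omega>"
        using c t by (auto simp: X_def)
      then show ?case
        by (simp add: X_def exp_add[symmetric] algebra_simps)
    qed
  qed
  also have "\<dots> = ennreal (\<integral>\<omega>. ?E1 \<omega> * ?E2 \<omega> \<partial>M)"
    by (intro nn_integral_eq_integral indep_var_integrable[OF ind int]) auto
  also have "(\<integral>\<omega>. ?E1 \<omega> * ?E2 \<omega> \<partial>M) = (\<integral>\<omega>. ?E1 \<omega> \<partial>M) * (\<integral>\<omega>. ?E2 \<omega> \<partial>M)"
    by (rule indep_var_lebesgue_integral[OF ind int])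
  also have "\<dots> = exp (- t * \<gamma> powr \<alpha>) * exp (- t * (c * \<gamma>) powr \<beta>)"
    using stable_subordinator_regular(3)[OF M S1 t \<gamma>] stable_subordinator_regular(3)[OF M S2 t, of "c * \<gamma>"] c \<gamma>
    by simp
  also have "\<dots> = exp (- t * (\<gamma> powr \<alpha> + (c * \<gamma>) powr \<beta>))"
    by (simp add: exp_add[symmetric] algebra_simps)
  finally show ?thesis .
qed

text \<open>This is the fundamental theorem of calculus at a point of continuity. It expresses the
  density through distribution functions, whose dependence on t is controlled by the monotone
  paths.\<close>

lemma law_density_LIMSEQ:
  assumes t: "0 < t" and x: "0 < x"
  shows "(\<lambda>n. (prob {\<omega>\<in>space M. X t \<omega> \<le> x + inverse (real (Suc n))} - prob {\<omega>\<in>space M. X t \<omega> \<le> x})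
    * real (Suc n)) \<longlonglongrightarrow> h x t"
proof -
  note [measurable] = law_densityD(4,5)[OF t]
  \<comment> \<open>The base point x/2 keeps the integration where h is known to be continuous; the
    mass below x/2 is a constant that cancels in the difference quotients.\<close>
  define \<Phi> where "\<Phi> u = integral {x / 2..u} (\<lambda>y. h y t)" for u
  have cont: "continuous_on {a..b} (\<lambda>y. h y t)" if "0 < a" for a b
    by (rule continuous_on_subset[OF law_densityD(3)[OF t]]) (use that in auto)
  have "(\<Phi> has_vector_derivative h x t) (at x within {x / 2..2 * x})"
    unfolding \<Phi>_def using x by (intro integral_has_vector_derivative cont) auto
  then have "(\<Phi> has_real_derivative h x t) (at x)"
    using x by (simp add: has_real_derivative_iff_has_vector_derivative at_within_Icc_at)
  from DERIV_imp_LIMSEQ[OF this]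
  have lim: "(\<lambda>n. (\<Phi> (x + inverse (real (Suc n))) - \<Phi> x) * real (Suc n)) \<longlonglongrightarrow> h x t" .
  have \<Phi>: "prob {\<omega>\<in>space M. X t \<omega> \<le> u} = prob {\<omega>\<in>space M. X t \<omega> < x / 2} + \<Phi> u" if "x / 2 \<le> u" for u
  proof -
    have "ennreal (\<Phi> u) = (\<integral>\<^sup>+y. ennreal (indicator {x / 2..u} y * h y t) \<partial>lborel)"
      unfolding \<Phi>_def using law_densityD(1)[OF t] x
      by (intro nn_integral_has_integral_lebesgue[symmetric] integrable_integral integrable_continuous_real cont) auto
    also have "\<dots> = (\<integral>\<^sup>+y. ennreal (h y t) * indicator {x / 2..u} y \<partial>lborel)"
      by (intro nn_integral_cong) (auto simp: indicator_def)
    also have "\<dots> = emeasure M (X t -` {x / 2..u} \<inter> space M)"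
      by (rule distributed_emeasure[OF law_densityD(2)[OF t], symmetric]) simp
    finally have "\<Phi> u = prob (X t -` {x / 2..u} \<inter> space M)"
      using law_densityD(1)[OF t] x unfolding \<Phi>_def emeasure_eq_measure
      by (subst (asm) ennreal_inj) (auto intro!: integral_nonneg integrable_continuous_real cont)
    moreover have "prob ({\<omega>\<in>space M. X t \<omega> < x / 2} \<union> (X t -` {x / 2..u} \<inter> space M)) =
        prob {\<omega>\<in>space M. X t \<omega> < x / 2} + prob (X t -` {x / 2..u} \<inter> space M)"
      by (rule finite_measure_Union) (auto intro!: measurable_sets)
    moreover have "{\<omega>\<in>space M. X t \<omega> < x / 2} \<union> (X t -` {x / 2..u} \<inter> space M) = {\<omega>\<in>space M. X t \<omega> \<le> u}"
      using that by auto
    ultimately show ?thesis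
      by simp
  qed
  have "x / 2 \<le> x + inverse (real (Suc n))" for n
    using x by (simp add: add_increasing2)
  then show ?thesis
    using lim x by (simp add: \<Phi>)
qed

text \<open>Monotone functions are Borel, so each quotient of distribution functions is measurable
  in t and so is its limit h(x,t). Together with continuity in x this gives joint measurability, on
  which every later use of Tonelli's theorem relies.\<close>

lemma borel_measurable_law_density:
  "(\<lambda>p. if 0 < fst p then (if 0 < snd p then ennreal (h (fst p) (snd p)) else 0) else 0)
    \<in> borel_measurable (borel \<Otimes>\<^sub>M borel)"
proof (rule borel_measurable_caratheodory[where f="\<lambda>x t. if 0 < t then ennreal (h x t) else 0"])
  show "continuous_on {0<..} (\<lambda>x. if 0 < t then ennreal (h x t) else 0)" for t
    using law_densityD(3)[of t] by (cases "0 < t") (auto intro: continuous_on_ennreal)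
next
  fix x :: real
  assume x: "0 < x"
  \<comment> \<open>The value 1 for t \<le> 0 is the largest possible one, so \<open>P y\<close> is
    antitone on the whole line.\<close>
  define P where "P y t = (if 0 < t then prob {\<omega>\<in>space M. X t \<omega> \<le> y} else 1)" for y t
  have "mono (\<lambda>t. - P y t)" for y
  proof (rule monoI)
    fix s t :: real
    assume "s \<le> t"
    have "prob {\<omega>\<in>space M. X t \<omega> \<le> y} \<le> prob {\<omega>\<in>space M. X s \<omega> \<le> y}" if "0 < s"
    proof (rule finite_measure_mono_AE)
      show "AE \<omega> in M. \<omega> \<in> {\<omega>\<in>space M. X t \<omega> \<le> y} \<longrightarrow> \<omega> \<in> {\<omega>\<in>space M. X s \<omega> \<le> y}"
        using sum_stable_mono
        by eventually_elim (use that \<open>s \<le> t\<close> in \<open>force dest: mono_onD[of _ _ s t]\<close>)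
      show "{\<omega>\<in>space M. X s \<omega> \<le> y} \<in> events"
        using law_densityD(5)[OF that] by measurable
    qed
    then show "- P y s \<le> - P y t"
      using \<open>s \<le> t\<close> by (auto simp: P_def)
  qed
  then have "(\<lambda>t. - (- P y t)) \<in> borel_measurable borel" for y
    by (intro borel_measurable_uminus borel_measurable_mono)
  then have [measurable]: "P y \<in> borel_measurable borel" for y
    by simp
  define Q where "Q n t = (if 0 < t then ennreal ((P (x + inverse (real (Suc n))) t - P x t) * real (Suc n)) else 0)" for n t
  have [measurable]: "Q n \<in> borel_measurable borel" for n
    unfolding Q_def by measurable
  have "(\<lambda>n. Q n t) \<longlonglongrightarrow> (if 0 < t then ennreal (h x t) else 0)" for t
    using tendsto_ennrealI[OF law_density_LIMSEQ[OF _ x, of t]] by (auto simp: Q_def P_def)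
  then have "(\<lambda>t. if 0 < t then ennreal (h x t) else 0) = (\<lambda>t. liminf (\<lambda>n. Q n t))"
    by (auto intro!: ext lim_imp_Liminf[symmetric])
  then show "(\<lambda>t. if 0 < t then ennreal (h x t) else 0) \<in> borel_measurable borel"
    by simp
qed

text \<open>For order 1 the first summand is the drift t and the second is nonnegative, so the law
  puts no mass on (0,t); continuity turns vanishing almost everywhere into vanishing.\<close>

lemma law_density_eq_0:
  assumes \<alpha>: "\<alpha> = 1" and x: "0 < x" "x < t"
  shows "h x t = 0"
proof -
  have t: "0 < t"
    using x by simp
  have H1: "H1 t \<omega> = t" if "\<omega> \<in> space M" for \<omega>
    using S1 \<alpha> t that by (auto simp: stable_subordinator_def)
  have "AE \<omega> in M. t \<le> X t \<omega>"
    using sum_stable_mono AE_space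
    by eventually_elim (use c t H1 in \<open>auto simp: X_def\<close>)
  then have "emeasure M {\<omega> \<in> space M. X t \<omega> \<in> {0<..<t}} = 0"
    by (intro emeasure_eq_0_AE) (auto elim!: eventually_mono)
  moreover have "{\<omega> \<in> space M. X t \<omega> \<in> {0<..<t}} = X t -` {0<..<t} \<inter> space M"
    by auto
  ultimately have "emeasure M (X t -` {0<..<t} \<inter> space M) = 0"
    by metis
  then have "(\<integral>\<^sup>+y. ennreal (h y t) * indicator {0<..<t} y \<partial>lborel) = 0"
    by (subst (asm) distributed_emeasure[OF law_densityD(2)[OF t]]) auto
  then have "AE y in lborel. ennreal (h y t) * indicator {0<..<t} y = 0"
    by (subst (asm) nn_integral_0_iff_AE) (use law_densityD(4)[OF t] in auto)
  then have "AE y in lborel. y \<in> {0<..<t} \<longrightarrow> h y t = 0"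
    by eventually_elim (use law_densityD(1)[OF t] in \<open>auto simp: indicator_def ennreal_eq_0_iff antisym\<close>)
  then show ?thesis
    by (rule AE_eq_imp_eq_on_open)
      (use x in \<open>auto intro!: continuous_on_subset[OF law_densityD(3)[OF t]]\<close>)
qed

end

section \<open>The Laplace transform in time\<close>

lemma quadratic_factorization:
  fixes l \<mu> :: real
  assumes "\<mu> < l\<^sup>2"
  shows "(z - (- l + sqrt (l\<^sup>2 - \<mu>))) * (z - (- l - sqrt (l\<^sup>2 - \<mu>))) = \<mu> + (z\<^sup>2 + 2 * l * z)"
proof -
  have "(sqrt (l\<^sup>2 - \<mu>))\<^sup>2 = l\<^sup>2 - \<mu>"
    using assms by simp
  then show ?thesis
    by (simp add: algebra_simps power2_eq_square)
qed

text \<open>This isolates the analytic half: from here on only these properties of h are used,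
  together with its vanishing for x < t when \<nu> = 1/2. The processes no longer appear.\<close>

locale time_changed_density =
  fixes \<nu> l \<mu> :: real and h :: "real \<Rightarrow> real \<Rightarrow> real"
  assumes \<nu>: "0 < \<nu>" and l: "0 < l" and \<mu>: "0 < \<mu>" "\<mu> < l\<^sup>2"
    and h_nonneg: "\<And>x t. 0 < t \<Longrightarrow> 0 \<le> h x t"
    and h_continuous: "\<And>t. 0 < t \<Longrightarrow> continuous_on {0<..} (\<lambda>x. h x t)"
    and h_measurable: "(\<lambda>p. if 0 < fst p then (if 0 < snd p then ennreal (h (fst p) (snd p)) else 0) else 0)
      \<in> borel_measurable (borel \<Otimes>\<^sub>M borel)"
    and laplace_h: "\<And>t \<gamma>. 0 < t \<Longrightarrow> 0 < \<gamma> \<Longrightarrow>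
      laplace (\<lambda>x. ennreal (h x t)) \<gamma> = ennreal (exp (- t * (\<gamma> powr (2 * \<nu>) + 2 * l * \<gamma> powr \<nu>)))"
begin

definition \<psi> :: "real \<Rightarrow> real" where
  "\<psi> \<gamma> = \<gamma> powr (2 * \<nu>) + 2 * l * \<gamma> powr \<nu>"

definition H :: "real \<Rightarrow> real \<Rightarrow> ennreal" where
  "H x t = (if 0 < x then (if 0 < t then ennreal (h x t) else 0) else 0)"

text \<open>With the weight \<open>rl_kernel 1\<close>, which is 1 for t > 0, this is the wanted
  transform in t; the weight \<open>rl_kernel 2\<close>, which is t, arises from the factor t in the
  size-biasing identity.\<close>

definition mix :: "(real \<Rightarrow> ennreal) \<Rightarrow> real \<Rightarrow> ennreal" where
  "mix w x = (\<integral>\<^sup>+t. ennreal (exp (- \<mu> * t)) * w t * H x t \<partial>lborel)"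

definition G :: "real \<Rightarrow> real" where
  "G x = x powr (\<nu> - 1) / (2 * sqrt (l\<^sup>2 - \<mu>)) *
    (mittag_leffler \<nu> \<nu> ((- l + sqrt (l\<^sup>2 - \<mu>)) * x powr \<nu>)
      - mittag_leffler \<nu> \<nu> ((- l - sqrt (l\<^sup>2 - \<mu>)) * x powr \<nu>))"

lemma \<psi>_pos: "0 < \<gamma> \<Longrightarrow> 0 < \<psi> \<gamma>"
  using l by (simp add: \<psi>_def add_pos_pos)

lemma sqrt_bounds: "0 < sqrt (l\<^sup>2 - \<mu>)" "sqrt (l\<^sup>2 - \<mu>) < l"
proof -
  show "0 < sqrt (l\<^sup>2 - \<mu>)"
    using \<mu> by simp
  have "sqrt (l\<^sup>2 - \<mu>) < sqrt (l\<^sup>2)"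
    using \<mu> by (intro real_sqrt_less_mono) simp
  then show "sqrt (l\<^sup>2 - \<mu>) < l"
    using l by simp
qed

lemma measurable_H [measurable]: "(\<lambda>p. H (fst p) (snd p)) \<in> borel_measurable (borel \<Otimes>\<^sub>M borel)"
  using h_measurable unfolding H_def .

lemma measurable_H' [measurable (raw)]:
  assumes [measurable]: "f \<in> borel_measurable N" "g \<in> borel_measurable N"
  shows "(\<lambda>z. H (f z) (g z)) \<in> borel_measurable N"
proof -
  have "(\<lambda>z. (f z, g z)) \<in> N \<rightarrow>\<^sub>M borel \<Otimes>\<^sub>M borel"
    by measurable
  from measurable_compose[OF this measurable_H] show ?thesis
    by simp
qed

lemma measurable_mix [measurable (raw)]:
  assumes [measurable]: "w \<in> borel_measurable borel"
  shows "mix w \<in> borel_measurable borel"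
  unfolding mix_def by measurable

lemma H_eq: "0 < x \<Longrightarrow> 0 < t \<Longrightarrow> H x t = ennreal (h x t)"
  by (simp add: H_def)

lemma H_eq_0: "\<not> 0 < t \<Longrightarrow> H x t = 0"
  by (simp add: H_def)

lemma continuous_on_H: "continuous_on {0<..} (\<lambda>x. H x t)"
proof (cases "0 < t")
  case True
  then show ?thesis
    using continuous_on_ennreal[OF h_continuous[OF True]]
    by (subst continuous_on_cong[where g="\<lambda>x. ennreal (h x t)"]) (auto simp: H_eq)
qed (simp add: H_eq_0)

lemma laplace_H: "0 < t \<Longrightarrow> 0 < \<gamma> \<Longrightarrow> laplace (\<lambda>x. H x t) \<gamma> = ennreal (exp (- t * \<psi> \<gamma>))"
  unfolding \<psi>_def by (subst laplace_h[symmetric])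
    (auto simp: laplace_def H_def indicator_def intro!: nn_integral_cong)

text \<open>By Tonelli the x-transform is taken first and gives exp (- t \<psi>(\<gamma>)), which
  merely shifts the argument of the t-transform of the weight from \<mu> to \<mu> +
  \<psi>(\<gamma>).\<close>

lemma laplace_mix:
  assumes [measurable]: "w \<in> borel_measurable borel" and \<gamma>: "0 < \<gamma>"
  shows "laplace (mix w) \<gamma> = laplace w (\<mu> + \<psi> \<gamma>)"
proof -
  let ?k = "\<lambda>x t. ennreal (exp (- \<mu> * t)) * w t * (ennreal (exp (- \<gamma> * x)) * H x t * indicator {0<..} x)"
  have "laplace (mix w) \<gamma> = (\<integral>\<^sup>+x. \<integral>\<^sup>+t. ?k x t \<partial>lborel \<partial>lborel)"
    unfolding laplace_def
  proof (intro nn_integral_cong)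
    fix x :: real
    have "ennreal (exp (- \<gamma> * x)) * mix w x * indicator {0<..} x = mix w x * (ennreal (exp (- \<gamma> * x)) * indicator {0<..} x)"
      by (simp only: mult_ac)
    also have "\<dots> = (\<integral>\<^sup>+t. ennreal (exp (- \<mu> * t)) * w t * H x t * (ennreal (exp (- \<gamma> * x)) * indicator {0<..} x) \<partial>lborel)"
      unfolding mix_def by (rule nn_integral_multc[symmetric]) measurable
    also have "\<dots> = (\<integral>\<^sup>+t. ?k x t \<partial>lborel)"
      by (simp only: mult_ac)
    finally show "ennreal (exp (- \<gamma> * x)) * mix w x * indicator {0<..} x = (\<integral>\<^sup>+t. ?k x t \<partial>lborel)" .
  qed
  also have "\<dots> = (\<integral>\<^sup>+t. \<integral>\<^sup>+x. ?k x t \<partial>lborel \<partial>lborel)"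
    by (rule lborel_pair.Fubini') measurable
  also have "\<dots> = (\<integral>\<^sup>+t. ennreal (exp (- (\<mu> + \<psi> \<gamma>) * t)) * w t * indicator {0<..} t \<partial>lborel)"
  proof (intro nn_integral_cong)
    fix t :: real
    have "(\<integral>\<^sup>+x. ?k x t \<partial>lborel) = ennreal (exp (- \<mu> * t)) * w t * laplace (\<lambda>x. H x t) \<gamma>"
      unfolding laplace_def by (rule nn_integral_cmult) measurable
    also have "\<dots> = ennreal (exp (- (\<mu> + \<psi> \<gamma>) * t)) * w t * indicator {0<..} t"
    proof (cases "0 < t")
      case True
      have "exp (- (\<mu> + \<psi> \<gamma>) * t) = exp (- \<mu> * t) * exp (- t * \<psi> \<gamma>)"
        by (simp add: exp_add[symmetric] algebra_simps)
      then show ?thesis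
        using True \<gamma> by (simp add: laplace_H ennreal_mult mult_ac)
    next
      case False
      then show ?thesis
        by (simp add: H_eq_0 laplace_def)
    qed
    finally show "(\<integral>\<^sup>+x. ?k x t \<partial>lborel) = ennreal (exp (- (\<mu> + \<psi> \<gamma>) * t)) * w t * indicator {0<..} t" .
  qed
  finally show ?thesis
    unfolding laplace_def .
qed

lemma laplace_mix_rl_kernel:
  assumes "0 < a" "0 < \<gamma>"
  shows "laplace (mix (rl_kernel a)) \<gamma> = ennreal ((\<mu> + \<psi> \<gamma>) powr (- a))"
  using assms \<psi>_pos[of \<gamma>] \<mu> by (simp add: laplace_mix laplace_rl_kernel)

lemma continuous_on_G: "continuous_on {0<..} G"
proof -
  have "continuous_on UNIV (mittag_leffler \<nu> \<nu>)"
    using isCont_mittag_leffler[OF \<nu> \<nu>] by (simp add: continuous_at_imp_continuous_on)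
  then have "continuous_on {0<..} (\<lambda>x. mittag_leffler \<nu> \<nu> (r * x powr \<nu>))" for r
    by (rule continuous_on_compose2) (auto intro!: continuous_intros)
  then show ?thesis
    unfolding G_def using sqrt_bounds by (intro continuous_intros) auto
qed

lemma measurable_G: "(\<lambda>x. if 0 < x then G x else 0) \<in> borel_measurable borel"
proof -
  have "G \<in> borel_measurable (restrict_space borel {0<..})"
    by (rule borel_measurable_continuous_on_restrict[OF continuous_on_G])
  then have "(\<lambda>x. indicator {0<..} x *\<^sub>R G x) \<in> borel_measurable borel"
    by (subst (asm) borel_measurable_restrict_space_iff) auto
  moreover have "(\<lambda>x. indicator {0<..} x *\<^sub>R G x) = (\<lambda>x. if 0 < x then G x else 0)"
    by (auto simp: fun_eq_iff)
  ultimately show ?thesis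
    by simp
qed

text \<open>
  For \<open>\<gamma> \<ge> \<gamma>\<^sub>0\<close> the power \<open>\<gamma>\<^bsup>\<nu>\<^esup>\<close> exceeds \<open>l + sqrt (l\<^sup>2 - \<mu>)\<close>, so both Mittag-Leffler terms
  can be transformed termwise.
\<close>

definition \<gamma>\<^sub>0 :: real where
  "\<gamma>\<^sub>0 = (3 * l) powr (1 / \<nu>)"

lemma \<gamma>\<^sub>0_pos: "0 < \<gamma>\<^sub>0"
  using l by (simp add: \<gamma>\<^sub>0_def)

lemma has_bochner_integral_G:
  assumes \<gamma>: "\<gamma>\<^sub>0 \<le> \<gamma>"
  shows "has_bochner_integral lborel (\<lambda>x. exp (- \<gamma> * x) * G x * indicator {0<..} x) (1 / (\<mu> + \<psi> \<gamma>))"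
proof -
  let ?s = "sqrt (l\<^sup>2 - \<mu>)"
  have \<gamma>': "0 < \<gamma>"
    using \<gamma> \<gamma>\<^sub>0_pos by linarith
  \<comment> \<open>The square root is below l, so both roots have modulus below 2 l; the constant 3
    leaves room for the strict inequality.\<close>
  have "3 * l = \<gamma>\<^sub>0 powr \<nu>"
    using l \<nu> by (simp add: \<gamma>\<^sub>0_def powr_powr)
  also have "\<dots> \<le> \<gamma> powr \<nu>"
    using \<gamma> \<gamma>\<^sub>0_pos \<nu> by (intro powr_mono2) auto
  finally have big: "3 * l \<le> \<gamma> powr \<nu>" .
  have r: "\<bar>- l + ?s\<bar> < \<gamma> powr \<nu>" "\<bar>- l - ?s\<bar> < \<gamma> powr \<nu>"
    using big sqrt_bounds l by linarith+
  let ?I = "\<lambda>r x. exp (- \<gamma> * x) * (x powr (\<nu> - 1) * mittag_leffler \<nu> \<nu> (r * x powr \<nu>)) * indicator {0<..} x"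
  have "has_bochner_integral lborel (\<lambda>x. (?I (- l + ?s) x - ?I (- l - ?s) x) / (2 * ?s))
    ((1 / (\<gamma> powr \<nu> - (- l + ?s)) - 1 / (\<gamma> powr \<nu> - (- l - ?s))) / (2 * ?s))"
    by (intro has_bochner_integral_divide has_bochner_integral_diff
        has_bochner_integral_mittag_leffler[OF \<nu> \<gamma>'] r)
  moreover have "(?I (- l + ?s) x - ?I (- l - ?s) x) / (2 * ?s) = exp (- \<gamma> * x) * G x * indicator {0<..} x" for x
    by (simp add: G_def field_simps)
  moreover have "(1 / (\<gamma> powr \<nu> - (- l + ?s)) - 1 / (\<gamma> powr \<nu> - (- l - ?s))) / (2 * ?s) = 1 / (\<mu> + \<psi> \<gamma>)"
  proof -
    have partial_fractions: "(1 / a - 1 / b) / (2 * s) = 1 / (a * b)" if "0 < a" "0 < b" "b - a = 2 * s" "0 < s" for a b s :: real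
      using that by (simp add: diff_frac_eq)
    have "(1 / (\<gamma> powr \<nu> - (- l + ?s)) - 1 / (\<gamma> powr \<nu> - (- l - ?s))) / (2 * ?s)
      = 1 / ((\<gamma> powr \<nu> - (- l + ?s)) * (\<gamma> powr \<nu> - (- l - ?s)))"
      using r sqrt_bounds(1) by (intro partial_fractions) linarith+
    also have "(\<gamma> powr \<nu> - (- l + ?s)) * (\<gamma> powr \<nu> - (- l - ?s)) = \<mu> + \<psi> \<gamma>"
    proof -
      have "(\<gamma> powr \<nu>)\<^sup>2 = \<gamma> powr (2 * \<nu>)"
        using \<gamma>' by (simp add: power2_eq_square powr_add[symmetric])
      then show ?thesis
        unfolding quadratic_factorization[OF \<mu>(2)] \<psi>_def by simp
    qed
    finally show ?thesis .
  qed
  ultimately show ?thesis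
    by simp
qed

text \<open>Uniqueness is available for \<open>ennreal\<close> functions only and the sign of
  \<open>G\<close> is still open. So the negative part of \<open>G\<close> is added to the mixture,
  and the sum has the same finite transform as the positive part. Where \<open>G\<close> were
  negative the positive part would be 0, forcing the negative part to be 0 too, a
  contradiction.\<close>

lemma mix_eq_G_AE:
  shows "AE x in lborel. 0 < x \<longrightarrow> mix (rl_kernel 1) x = ennreal (G x)"
    and "0 < x \<Longrightarrow> 0 \<le> G x"
proof -
  define G' where "G' x = (if 0 < x then G x else 0)" for x
  have [measurable]: "G' \<in> borel_measurable borel"
    unfolding G'_def by (rule measurable_G)
  have lap: "laplace (\<lambda>x. mix (rl_kernel 1) x + ennreal (- G' x)) \<gamma> = laplace (\<lambda>x. ennreal (G' x)) \<gamma>"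
    and fin: "laplace (\<lambda>x. mix (rl_kernel 1) x + ennreal (- G' x)) \<gamma> < \<infinity>" if "\<gamma>\<^sub>0 \<le> \<gamma>" for \<gamma>
  proof -
    have \<gamma>': "0 < \<gamma>"
      using that \<gamma>\<^sub>0_pos by linarith
    let ?f = "\<lambda>x. exp (- \<gamma> * x) * G x * indicator {0<..} x"
    have P: "laplace (\<lambda>x. ennreal (G' x)) \<gamma> = (\<integral>\<^sup>+x. ennreal (?f x) \<partial>lborel)"
      and N: "laplace (\<lambda>x. ennreal (- G' x)) \<gamma> = (\<integral>\<^sup>+x. ennreal (- ?f x) \<partial>lborel)"
    proof -
      have "ennreal (exp (- \<gamma> * x)) * ennreal (c * G' x) * indicator {0<..} x = ennreal (c * ?f x)" for c x
        using ennreal_mult'[of "exp (- \<gamma> * x)" "c * G x", symmetric]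
        by (cases "0 < x") (simp_all add: G'_def mult.left_commute)
      from this[where c=1] this[where c="-1"] show
        "laplace (\<lambda>x. ennreal (G' x)) \<gamma> = (\<integral>\<^sup>+x. ennreal (?f x) \<partial>lborel)"
        "laplace (\<lambda>x. ennreal (- G' x)) \<gamma> = (\<integral>\<^sup>+x. ennreal (- ?f x) \<partial>lborel)"
        unfolding laplace_def by simp_all
    qed
    have int: "integrable lborel ?f" "integral\<^sup>L lborel ?f = 1 / (\<mu> + \<psi> \<gamma>)"
      using has_bochner_integral_G[OF that] by (auto simp: has_bochner_integral_iff)
    have Pf: "(\<integral>\<^sup>+x. ennreal (?f x) \<partial>lborel) < \<infinity>" and Nf: "(\<integral>\<^sup>+x. ennreal (- ?f x) \<partial>lborel) < \<infinity>"
      using int(1) by (auto simp: real_integrable_def less_top)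
    have diff: "1 / (\<mu> + \<psi> \<gamma>) = enn2real (\<integral>\<^sup>+x. ennreal (?f x) \<partial>lborel) - enn2real (\<integral>\<^sup>+x. ennreal (- ?f x) \<partial>lborel)"
      using real_lebesgue_integral_def[OF int(1)] int(2) by simp
    have add: "ennreal c + B = A" if "c = enn2real A - enn2real B" "0 \<le> c" "A < \<infinity>" "B < \<infinity>" for A B c
    proof -
      have "ennreal c + ennreal (enn2real B) = ennreal (enn2real A)"
        using that(1,2) by (simp flip: ennreal_plus)
      with that(3,4) show ?thesis
        by simp
    qed
    have "ennreal (1 / (\<mu> + \<psi> \<gamma>)) + (\<integral>\<^sup>+x. ennreal (- ?f x) \<partial>lborel) = (\<integral>\<^sup>+x. ennreal (?f x) \<partial>lborel)"
      by (rule add[OF diff _ Pf Nf]) (use \<psi>_pos[OF \<gamma>'] \<mu>(1) in simp)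
    moreover have "laplace (mix (rl_kernel 1)) \<gamma> = ennreal (1 / (\<mu> + \<psi> \<gamma>))"
      using laplace_mix_rl_kernel[of 1 \<gamma>] \<gamma>' \<psi>_pos[OF \<gamma>'] \<mu> by (simp add: powr_minus_divide)
    ultimately show "laplace (\<lambda>x. mix (rl_kernel 1) x + ennreal (- G' x)) \<gamma> = laplace (\<lambda>x. ennreal (G' x)) \<gamma>"
      by (simp add: laplace_add P N)
    with Pf show "laplace (\<lambda>x. mix (rl_kernel 1) x + ennreal (- G' x)) \<gamma> < \<infinity>"
      by (simp add: P)
  qed
  have "AE x in lborel. 0 < x \<longrightarrow> mix (rl_kernel 1) x + ennreal (- G' x) = ennreal (G' x)"
    by (rule laplace_unique[where \<gamma>\<^sub>0=\<gamma>\<^sub>0]) (use lap fin in auto)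
  then have AE: "AE x in lborel. 0 < x \<longrightarrow> 0 \<le> G x \<and> mix (rl_kernel 1) x = ennreal (G x)"
  proof eventually_elim
    case (elim x)
    show ?case
    proof
      assume x: "0 < x"
      then have eq: "mix (rl_kernel 1) x + ennreal (- G x) = ennreal (G x)"
        using elim by (simp add: G'_def)
      have "0 \<le> G x"
      proof (rule ccontr)
        assume "\<not> 0 \<le> G x"
        then have "ennreal (- G x) = 0"
          using eq by (simp add: ennreal_neg)
        with \<open>\<not> 0 \<le> G x\<close> show False
          by (simp add: ennreal_eq_0_iff)
      qed
      with eq show "0 \<le> G x \<and> mix (rl_kernel 1) x = ennreal (G x)"
        by (simp add: ennreal_neg)
    qed
  qed
  then show "AE x in lborel. 0 < x \<longrightarrow> mix (rl_kernel 1) x = ennreal (G x)"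
    by eventually_elim auto
  \<comment> \<open>The inequality 0 \<le> G x is encoded as an equation between continuous
    functions so that it can be carried from almost every x to every x.\<close>
  have "AE x in lborel. x \<in> {0<..} \<longrightarrow> max 0 (G x) = G x"
    using AE by eventually_elim auto
  then have "0 < x \<Longrightarrow> max 0 (G x) = G x"
    by (rule AE_eq_imp_eq_on_open) (auto intro!: continuous_on_max continuous_on_G)
  then show "0 < x \<Longrightarrow> 0 \<le> G x"
    by simp
qed

end

section \<open>The formula at every point for \<nu> < 1/2\<close>

lemma laplace_cong_AE:
  "AE x in lborel. 0 < x \<longrightarrow> f x = g x \<Longrightarrow> laplace f \<gamma> = laplace g \<gamma>"
  unfolding laplace_def by (intro nn_integral_cong_AE) (auto elim!: eventually_mono simp: indicator_def)

lemma rl_kernel_finite: "rl_kernel a u < \<infinity>"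
  by (simp add: rl_kernel_def)

context time_changed_density
begin

definition G' :: "real \<Rightarrow> ennreal" where
  "G' x = ennreal (if 0 < x then G x else 0)"

lemma measurable_G' [measurable]: "G' \<in> borel_measurable borel"
  unfolding G'_def using measurable_G by measurable

lemma mix_eq_G'_AE: "AE x in lborel. 0 < x \<longrightarrow> mix (rl_kernel 1) x = G' x"
  using mix_eq_G_AE(1) by eventually_elim (simp add: G'_def)

text \<open>Termwise integration reached only \<gamma> \<ge> \<gamma>0. The transform of the mixture
  is known for all \<gamma> > 0, and equality almost everywhere hands it over to
  \<open>G'\<close>.\<close>

lemma laplace_G': "0 < \<gamma> \<Longrightarrow> laplace G' \<gamma> = ennreal (1 / (\<mu> + \<psi> \<gamma>))"
  using laplace_cong_AE[OF mix_eq_G'_AE] laplace_mix_rl_kernel[of 1 \<gamma>] \<psi>_pos[of \<gamma>] \<mu>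
  by (simp add: powr_minus_divide)

lemma continuous_on_G': "continuous_on {0<..} G'"
  using continuous_on_ennreal[OF continuous_on_G]
  by (subst continuous_on_cong[where g="\<lambda>x. ennreal (G x)"]) (auto simp: G'_def)

lemma G'_finite: "G' x < \<infinity>"
  by (simp add: G'_def)

text \<open>Reduces the pointwise formula to continuity. The factor x is the one produced by size
  biasing, and it is cancelled at the end because x is positive and finite.\<close>

lemma mix_eq_G'I:
  assumes "continuous_on {0<..} (\<lambda>x. ennreal x * mix (rl_kernel 1) x)" and x: "0 < x"
  shows "mix (rl_kernel 1) x = G' x"
proof -
  have "continuous_on {0<..} (\<lambda>x. ennreal x * G' x)"
  proof -
    have "continuous_on {0<..} (\<lambda>x. ennreal (x * G x))"
      by (intro continuous_on_ennreal continuous_on_mult continuous_on_id continuous_on_G)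
    then show ?thesis
      by (subst continuous_on_cong[where g="\<lambda>x. ennreal (x * G x)"]) (auto simp: G'_def ennreal_mult')
  qed
  moreover have "AE x in lborel. x \<in> {0<..} \<longrightarrow> ennreal x * mix (rl_kernel 1) x = ennreal x * G' x"
    using mix_eq_G'_AE by eventually_elim auto
  ultimately have "ennreal x * mix (rl_kernel 1) x = ennreal x * G' x"
    using assms by (intro AE_eq_imp_eq_on_open[where f="\<lambda>x. ennreal x * mix (rl_kernel 1) x" and S="{0<..}"]) auto
  then show ?thesis
    using x by (auto simp: ennreal_mult_cancel_left)
qed

text \<open>
  Size biasing: as \<open>\<psi>'\<close> is the Laplace transform of \<open>kern\<close>, differentiating
  \<open>exp (- t \<psi>)\<close> gives \<open>x h(x,t) = t (kern * h(\<cdot>,t))(x)\<close> at every \<open>x\<close>. Mixing over \<open>t\<close>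
  makes \<open>x\<close> times the transform equal, at every \<open>x\<close>, to \<open>kern * (G' * G')\<close>, which is continuous.
\<close>

definition kern :: "real \<Rightarrow> ennreal" where
  "kern u = ennreal (2 * \<nu>) * rl_kernel (1 - 2 * \<nu>) u + ennreal (2 * l * \<nu>) * rl_kernel (1 - \<nu>) u"

lemma measurable_kern [measurable]: "kern \<in> borel_measurable borel"
  unfolding kern_def by measurable

lemma continuous_on_kern: "continuous_on {0<..} kern"
  unfolding kern_def
  by (intro continuous_on_add_ennreal ennreal_continuous_on_cmult continuous_on_rl_kernel) auto

lemma kern_finite: "kern u < \<infinity>"
  using rl_kernel_finite by (auto simp: kern_def ennreal_mult_less_top)

text \<open>This is where \<nu> < 1/2 enters: the kernel of order 1 - 2 \<nu> has a transform of the
  required form only for positive order.\<close>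

lemma laplace_kern:
  assumes "\<nu> < 1 / 2" "0 < \<gamma>"
  shows "laplace kern \<gamma> = ennreal (2 * \<nu> * \<gamma> powr (2 * \<nu> - 1) + 2 * l * \<nu> * \<gamma> powr (\<nu> - 1))"
  unfolding kern_def using assms \<nu> l
  by (simp add: laplace_add laplace_cmult laplace_rl_kernel ennreal_mult)

lemma DERIV_\<psi>:
  assumes "0 < \<gamma>"
  shows "(\<psi> has_real_derivative 2 * \<nu> * \<gamma> powr (2 * \<nu> - 1) + 2 * l * \<nu> * \<gamma> powr (\<nu> - 1)) (at \<gamma>)"
  unfolding \<psi>_def[abs_def] using assms by (auto intro!: derivative_eq_intros simp: powr_diff)

lemma size_bias:
  assumes \<nu>': "\<nu> < 1 / 2" and t: "0 < t" and x: "0 < x"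
  shows "ennreal x * H x t = ennreal t * conv kern (\<lambda>y. H y t) x"
proof (rule AE_eq_imp_eq_on_open[where f="\<lambda>x. ennreal x * H x t" and S="{0<..}"])
  have fin: "laplace (\<lambda>y. H y t) 1 < \<infinity>" "laplace kern 1 < \<infinity>"
    using t \<nu>' by (simp_all add: laplace_H laplace_kern)
  have Hfin: "H y t < \<infinity>" for y
    by (simp add: H_def)
  have lap: "laplace (\<lambda>x. ennreal x * H x t) \<gamma> = laplace (\<lambda>x. ennreal t * conv kern (\<lambda>y. H y t) x) \<gamma>"
    "laplace (\<lambda>x. ennreal x * H x t) \<gamma> < \<infinity>"
    if \<gamma>: "0 < \<gamma>" for \<gamma>
  proof -
    define d where "d = 2 * \<nu> * \<gamma> powr (2 * \<nu> - 1) + 2 * l * \<nu> * \<gamma> powr (\<nu> - 1)"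
    have d: "0 \<le> d"
      using \<nu> l by (simp add: d_def)
    have "((\<lambda>\<gamma>. exp (- t * \<psi> \<gamma>)) has_real_derivative - (t * d * exp (- t * \<psi> \<gamma>))) (at \<gamma>)"
      unfolding d_def by (rule derivative_eq_intros DERIV_\<psi> \<gamma> refl | simp)+
    then have "laplace (\<lambda>x. ennreal x * H x t) \<gamma> = ennreal (t * d * exp (- t * \<psi> \<gamma>))"
      by (rule laplace_times_ident[where \<gamma>\<^sub>0=0, rotated 3]) (use t \<gamma> laplace_H in auto)
    then show "laplace (\<lambda>x. ennreal x * H x t) \<gamma> = laplace (\<lambda>x. ennreal t * conv kern (\<lambda>y. H y t) x) \<gamma>"
      "laplace (\<lambda>x. ennreal x * H x t) \<gamma> < \<infinity>"
      using t \<gamma> \<nu>' d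
      by (simp_all add: laplace_cmult laplace_conv laplace_kern laplace_H ennreal_mult d_def mult.assoc ennreal_mult_less_top)
  qed
  have "AE x in lborel. 0 < x \<longrightarrow> ennreal x * H x t = ennreal t * conv kern (\<lambda>y. H y t) x"
    by (rule laplace_unique[where \<gamma>\<^sub>0=1]) (use lap[of 1] lap(1)[of "1 + real _"] in auto)
  then show "AE x in lborel. x \<in> {0<..} \<longrightarrow> ennreal x * H x t = ennreal t * conv kern (\<lambda>y. H y t) x"
    by simp
  show "continuous_on {0<..} (\<lambda>x. ennreal x * H x t)"
  proof -
    have "continuous_on {0<..} (\<lambda>x. ennreal (x * h x t))"
      by (intro continuous_on_ennreal continuous_on_mult continuous_on_id h_continuous t)
    then show ?thesis
      by (subst continuous_on_cong[where g="\<lambda>x. ennreal (x * h x t)"]) (auto simp: H_eq t ennreal_mult')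
  qed
  \<comment> \<open>Uniqueness gives the identity for almost every x; continuity of both sides, here
    by smoothing through the convolution, gives it at every x.\<close>
  show "continuous_on {0<..} (\<lambda>x. ennreal t * conv kern (\<lambda>y. H y t) x)"
    by (intro ennreal_continuous_on_cmult conv_regular(1)[where \<gamma>=1] continuous_on_kern continuous_on_H
        kern_finite Hfin fin) auto
qed (use x in auto)

lemma mix_eq_G'_less_half:
  assumes \<nu>': "\<nu> < 1 / 2" and x: "0 < x"
  shows "mix (rl_kernel 1) x = G' x"
proof (rule mix_eq_G'I[OF _ x])
  have rl: "rl_kernel 1 t = 1" "rl_kernel 2 t = ennreal t" if "0 < t" for t
    using that by (simp_all add: rl_kernel_def Gamma_numeral)
  \<comment> \<open>The transform (\<mu> + \<psi>)^(-2) is the square of that of \<open>G'\<close>.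
    Equality for almost every y is enough, since it is used only under the integral of the
    convolution with \<open>kern\<close>.\<close>
  have "AE y in lborel. 0 < y \<longrightarrow> mix (rl_kernel 2) y = conv G' G' y"
  proof (rule laplace_unique[where \<gamma>\<^sub>0=1])
    have "laplace (mix (rl_kernel 2)) \<gamma> = laplace (conv G' G') \<gamma>" if "0 < \<gamma>" for \<gamma>
    proof -
      have p: "0 < \<mu> + \<psi> \<gamma>"
        using \<mu> \<psi>_pos[OF that] by simp
      then have "(\<mu> + \<psi> \<gamma>) powr - 2 = 1 / (\<mu> + \<psi> \<gamma>) * (1 / (\<mu> + \<psi> \<gamma>))"
        by (simp add: powr_minus_divide power2_eq_square)
      then show ?thesis
        using that p by (simp add: laplace_mix_rl_kernel laplace_conv laplace_G' ennreal_mult[symmetric])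
    qed
    then show "laplace (mix (rl_kernel 2)) (1 + real n) = laplace (conv G' G') (1 + real n)" for n
      by simp
    show "laplace (mix (rl_kernel 2)) 1 < \<infinity>"
      by (simp add: laplace_mix_rl_kernel)
  qed measurable
  note G2 = this
  have "ennreal x * mix (rl_kernel 1) x = conv kern (conv G' G') x" if x: "0 < x" for x
  proof -
    let ?k = "\<lambda>y t. ennreal (exp (- \<mu> * t)) * rl_kernel 2 t * (if 0 < y \<and> y < x then kern (x - y) * H y t else 0)"
    have "ennreal x * mix (rl_kernel 1) x =
      (\<integral>\<^sup>+t. ennreal x * (ennreal (exp (- \<mu> * t)) * rl_kernel 1 t * H x t) \<partial>lborel)"
      unfolding mix_def by (rule nn_integral_cmult[symmetric]) measurable
    also have "\<dots> = (\<integral>\<^sup>+t. \<integral>\<^sup>+y. ?k y t \<partial>lborel \<partial>lborel)"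
    proof (intro nn_integral_cong)
      fix t :: real
      show "ennreal x * (ennreal (exp (- \<mu> * t)) * rl_kernel 1 t * H x t) = (\<integral>\<^sup>+y. ?k y t \<partial>lborel)"
      proof (cases "0 < t")
        case True
        have "(\<integral>\<^sup>+y. ?k y t \<partial>lborel) = ennreal (exp (- \<mu> * t)) * rl_kernel 2 t * conv kern (\<lambda>y. H y t) x"
          unfolding conv_def by (rule nn_integral_cmult) measurable
        also have "\<dots> = ennreal (exp (- \<mu> * t)) * (ennreal t * conv kern (\<lambda>y. H y t) x)"
          using True by (simp add: rl mult.assoc)
        also have "\<dots> = ennreal (exp (- \<mu> * t)) * (ennreal x * H x t)"
          by (simp only: size_bias[OF \<nu>' True x])
        finally show ?thesis
          using True by (simp add: rl mult_ac)
      next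
        case False
        then show ?thesis
          by (simp add: H_eq_0 cong: if_cong)
      qed
    qed
    also have "\<dots> = (\<integral>\<^sup>+y. \<integral>\<^sup>+t. ?k y t \<partial>lborel \<partial>lborel)"
      by (rule lborel_pair.Fubini') measurable
    also have "\<dots> = conv kern (mix (rl_kernel 2)) x"
      unfolding conv_def
    proof (intro nn_integral_cong)
      fix y :: real
      show "(\<integral>\<^sup>+t. ?k y t \<partial>lborel) = (if 0 < y \<and> y < x then kern (x - y) * mix (rl_kernel 2) y else 0)"
      proof (cases "0 < y \<and> y < x")
        case True
        then have "(\<integral>\<^sup>+t. ?k y t \<partial>lborel) =
          (\<integral>\<^sup>+t. kern (x - y) * (ennreal (exp (- \<mu> * t)) * rl_kernel 2 t * H y t) \<partial>lborel)"
          by (intro nn_integral_cong) (simp add: mult_ac)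
        also have "\<dots> = kern (x - y) * mix (rl_kernel 2) y"
          unfolding mix_def by (rule nn_integral_cmult) measurable
        finally show ?thesis
          using True by simp
      next
        case False
        then show ?thesis
          by (simp only: if_False) simp
      qed
    qed
    also have "\<dots> = conv kern (conv G' G') x"
      unfolding conv_def[of kern]
      by (intro nn_integral_cong_AE) (use G2 in \<open>auto elim!: eventually_mono\<close>)
    finally show ?thesis .
  qed
  moreover have "continuous_on {0<..} (conv kern (conv G' G'))"
  proof (rule conv_regular(1)[where \<gamma>=1])
    have fin: "laplace G' 1 < \<infinity>"
      by (simp add: laplace_G')
    show "continuous_on {0<..} (conv G' G')" "\<And>x. 0 < x \<Longrightarrow> conv G' G' x < \<infinity>"
      by (rule conv_regular[where \<gamma>=1]; use continuous_on_G' G'_finite fin in simp)+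
    show "laplace (conv G' G') 1 < \<infinity>"
      using fin by (simp add: laplace_conv ennreal_mult_less_top)
    show "laplace kern 1 < \<infinity>"
      using \<nu>' by (simp add: laplace_kern)
  qed (use continuous_on_kern kern_finite in auto)
  ultimately show "continuous_on {0<..} (\<lambda>x. ennreal x * mix (rl_kernel 1) x)"
    by (subst continuous_on_cong[where g="conv kern (conv G' G')"]) auto
qed

end

section \<open>The formula at every point for \<nu> = 1/2\<close>

lemma laplace_shift:
  assumes [measurable]: "f \<in> borel_measurable borel" and t: "0 < t"
    and zero: "\<And>x. 0 < x \<Longrightarrow> x < t \<Longrightarrow> f x = 0"
  shows "laplace (\<lambda>y. f (y + t)) \<gamma> = ennreal (exp (\<gamma> * t)) * laplace f \<gamma>"
proof -
  have "laplace f \<gamma> = (\<integral>\<^sup>+x. ennreal (exp (- \<gamma> * x)) * f x * indicator {t<..} x \<partial>lborel)"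
    unfolding laplace_def using AE_lborel_singleton[of t] zero t
    by (intro nn_integral_cong_AE) (auto elim!: eventually_mono simp: indicator_def)
  also have "\<dots> = (\<integral>\<^sup>+y. ennreal (exp (- \<gamma> * (t + 1 * y))) * f (t + 1 * y) * indicator {t<..} (t + 1 * y) \<partial>lborel)"
    by (subst nn_integral_real_affine[where c=1 and t=t]) auto
  finally have "ennreal (exp (\<gamma> * t)) * laplace f \<gamma> = (\<integral>\<^sup>+y. ennreal (exp (\<gamma> * t)) *
      (ennreal (exp (- \<gamma> * (t + 1 * y))) * f (t + 1 * y) * indicator {t<..} (t + 1 * y)) \<partial>lborel)"
    by (simp add: nn_integral_cmult)
  also have "\<dots> = laplace (\<lambda>y. f (y + t)) \<gamma>"
    unfolding laplace_def
  proof (intro nn_integral_cong)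
    fix y :: real
    have "ennreal (exp (\<gamma> * t)) * ennreal (exp (- \<gamma> * (t + 1 * y))) = ennreal (exp (- \<gamma> * y))"
      by (simp add: ennreal_mult[symmetric] exp_add[symmetric] algebra_simps)
    then show "ennreal (exp (\<gamma> * t)) * (ennreal (exp (- \<gamma> * (t + 1 * y))) * f (t + 1 * y) * indicator {t<..} (t + 1 * y))
      = ennreal (exp (- \<gamma> * y)) * f (y + t) * indicator {0<..} y"
      by (simp add: mult.assoc[symmetric] add.commute indicator_def)
  qed
  finally show ?thesis ..
qed

lemma conv_le:
  assumes [measurable]: "f \<in> borel_measurable borel" "g \<in> borel_measurable borel"
    and mono: "\<And>u. 0 < u \<Longrightarrow> u < x \<Longrightarrow> f u \<le> f x"
  shows "conv f g x \<le> f x * (ennreal (exp (\<bar>\<gamma>\<bar> * x)) * laplace g \<gamma>)"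
proof -
  have "conv f g x \<le> (\<integral>\<^sup>+y. f x * (if 0 < y \<and> y < x then g y else 0) \<partial>lborel)"
    unfolding conv_def by (intro nn_integral_mono) (auto intro!: mult_right_mono mono)
  also have "\<dots> = f x * (\<integral>\<^sup>+y. (if 0 < y \<and> y < x then g y else 0) \<partial>lborel)"
    by (rule nn_integral_cmult) measurable
  also have "\<dots> \<le> f x * (ennreal (exp (\<bar>\<gamma>\<bar> * x)) * laplace g \<gamma>)"
    by (intro mult_left_mono nn_integral_le_laplace) auto
  finally show ?thesis .
qed

text \<open>It will be applied with z proportional to 1 / sqrt y, where the fourth power produces
  exactly the y^2 that has to be cancelled in \<open>h_bound\<close>; 256 is 4^4.\<close>

lemma exp_minus_le_inverse_power4:
  fixes z :: real
  assumes "0 < z"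
  shows "exp (- z) \<le> 256 / z ^ 4"
proof -
  have "z / 4 \<le> exp (z / 4)"
    using exp_ge_add_one_self[of "z / 4"] by linarith
  then have "(z / 4) ^ 4 \<le> exp (z / 4) ^ 4"
    using assms by (intro power_mono) auto
  also have "\<dots> = exp z"
    by (simp add: exp_of_nat_mult[symmetric])
  finally show ?thesis
    using assms by (simp add: exp_minus field_simps)
qed

context time_changed_density
begin

context
  assumes half: "\<nu> = 1 / 2" and zero: "\<And>x t. 0 < x \<Longrightarrow> x < t \<Longrightarrow> h x t = 0"
begin

text \<open>Here \<psi>(\<gamma>) = \<gamma> + 2 l sqrt \<gamma>, and moving the origin to the drift
  t removes the linear term.\<close>

lemma laplace_shifted_H:
  assumes t: "0 < t" and \<gamma>: "0 < \<gamma>"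
  shows "laplace (\<lambda>y. H (y + t) t) \<gamma> = ennreal (exp (- 2 * l * t * sqrt \<gamma>))"
proof -
  have "laplace (\<lambda>y. H (y + t) t) \<gamma> = ennreal (exp (\<gamma> * t)) * laplace (\<lambda>x. H x t) \<gamma>"
    by (rule laplace_shift[OF _ t]) (measurable, simp add: H_def zero)
  also have "\<dots> = ennreal (exp (- 2 * l * t * sqrt \<gamma>))"
  proof -
    have "\<psi> \<gamma> = \<gamma> + 2 * l * sqrt \<gamma>"
      by (subst \<psi>_def) (use \<gamma> in \<open>simp add: half powr_half_sqrt\<close>)
    then show ?thesis
      using t \<gamma> by (simp add: laplace_H ennreal_mult[symmetric] exp_add[symmetric] algebra_simps)
  qed
  finally show ?thesis .
qed

text \<open>
  Differentiating the transform \<open>exp (- 2 l t \<surd>\<gamma>)\<close> of \<open>u(y) = h(y + t, t)\<close> twice expresses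
  \<open>y\<^sup>2 u(y)\<close> as the convolution of \<open>u\<close> with a bounded kernel, and the mass of \<open>u\<close> on \<open>(0, y)\<close>
  is at most \<open>exp (1 - 2 l t / \<surd>y)\<close> by Chernoff's bound with \<open>\<gamma> = 1 / y\<close>.
\<close>

lemma h_bound:
  assumes t: "0 < t" and y: "0 < y"
  shows "y\<^sup>2 * h (y + t) t \<le> (t * l / 2 * (sqrt y / Gamma (3 / 2)) + t\<^sup>2 * l\<^sup>2) * exp (1 - 2 * l * t / sqrt y)"
proof -
  \<comment> \<open>\<open>L1\<close> and \<open>L2\<close> are -L' and L''. One differentiation
    would give a kernel of order 1/2, unbounded at 0; the second one yields the orders 3/2 and 1
    found in \<open>K\<close>, whose transform is the factor of \<open>L\<close> in
    \<open>L2\<close>.\<close>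
  define L where "L \<gamma> = exp (- 2 * l * t * sqrt \<gamma>)" for \<gamma>
  define L1 where "L1 \<gamma> = t * l / sqrt \<gamma> * L \<gamma>" for \<gamma>
  define L2 where "L2 \<gamma> = (t * l / (2 * \<gamma> * sqrt \<gamma>) + t\<^sup>2 * l\<^sup>2 / \<gamma>) * L \<gamma>" for \<gamma>
  define u where "u y = H (y + t) t" for y
  define K where "K y = ennreal (t * l / 2) * rl_kernel (3 / 2) y + ennreal (t\<^sup>2 * l\<^sup>2) * rl_kernel 1 y" for y
  define B where "B y = (t * l / 2 * (sqrt y / Gamma (3 / 2)) + t\<^sup>2 * l\<^sup>2) * exp (1 - 2 * l * t / sqrt y)" for y
  have [measurable]: "u \<in> borel_measurable borel" "K \<in> borel_measurable borel"
    unfolding u_def K_def by measurable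
  have G32: "0 < Gamma (3 / 2 :: real)"
    by (rule Gamma_real_pos) simp
  have u: "laplace u \<gamma> = ennreal (L \<gamma>)" if "0 < \<gamma>" for \<gamma>
    unfolding u_def L_def by (rule laplace_shifted_H[OF t that])
  have DL: "(L has_real_derivative - L1 \<gamma>) (at \<gamma>)" if "0 < \<gamma>" for \<gamma>
  proof -
    have "(L has_real_derivative L \<gamma> * (- 2 * l * t * (inverse (sqrt \<gamma>) / 2))) (at \<gamma>)"
      unfolding L_def[abs_def] by (rule DERIV_chain2[OF DERIV_exp DERIV_cmult[OF DERIV_real_sqrt[OF that]]])
    moreover have "L \<gamma> * (- 2 * l * t * (inverse (sqrt \<gamma>) / 2)) = - L1 \<gamma>"
      by (simp add: L1_def inverse_eq_divide)
    ultimately show ?thesis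
      by (simp only:)
  qed
  have DL1: "(L1 has_real_derivative - L2 \<gamma>) (at \<gamma>)" if "0 < \<gamma>" for \<gamma>
  proof -
    have "((\<lambda>\<gamma>. inverse (sqrt \<gamma>)) has_real_derivative - (inverse (sqrt \<gamma>) / 2 * inverse (sqrt \<gamma> ^ Suc (Suc 0)))) (at \<gamma>)"
      using that by (intro DERIV_inverse_fun DERIV_real_sqrt) auto
    from DERIV_mult[OF DERIV_cmult[OF this, of "t * l"] DL[OF that]]
    have "(L1 has_real_derivative t * l * - (inverse (sqrt \<gamma>) / 2 * inverse (sqrt \<gamma> ^ Suc (Suc 0))) * L \<gamma>
        + - L1 \<gamma> * (t * l * inverse (sqrt \<gamma>))) (at \<gamma>)"
      by (simp only: L1_def[abs_def] divide_inverse)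
    moreover have "t * l * - (inverse (sqrt \<gamma>) / 2 * inverse (sqrt \<gamma> ^ Suc (Suc 0))) = - (t * l / (2 * \<gamma> * sqrt \<gamma>))"
      using that by (simp add: inverse_eq_divide)
    moreover have "- L1 \<gamma> * (t * l * inverse (sqrt \<gamma>)) = - (t\<^sup>2 * l\<^sup>2 / \<gamma>) * L \<gamma>"
    proof -
      have "inverse (sqrt \<gamma>) * inverse (sqrt \<gamma>) = inverse \<gamma>"
        using that by (simp flip: inverse_mult_distrib)
      moreover have "- (t * l * i * c) * (t * l * i) = - (t\<^sup>2 * l\<^sup>2 * (i * i)) * c" for i c
        by (simp add: power2_eq_square)
      ultimately show ?thesis
        unfolding L1_def divide_inverse by metis
    qed
    ultimately have "(L1 has_real_derivative - (t * l / (2 * \<gamma> * sqrt \<gamma>)) * L \<gamma> + - (t\<^sup>2 * l\<^sup>2 / \<gamma>) * L \<gamma>) (at \<gamma>)"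
      by (simp only:)
    moreover have "- (t * l / (2 * \<gamma> * sqrt \<gamma>)) * L \<gamma> + - (t\<^sup>2 * l\<^sup>2 / \<gamma>) * L \<gamma> = - L2 \<gamma>"
      by (simp add: L2_def algebra_simps)
    ultimately show ?thesis
      by (simp only:)
  qed
  have L_nonneg: "0 \<le> L \<gamma>" "0 \<le> L1 \<gamma>" if "0 < \<gamma>" for \<gamma>
    using t l that by (simp_all add: L_def L1_def)
  have lap1: "laplace (\<lambda>y. ennreal y * u y) \<gamma> = ennreal (L1 \<gamma>)" if "0 < \<gamma>" for \<gamma>
    by (rule laplace_times_ident[where \<gamma>\<^sub>0=0 and L=L]) (use u L_nonneg DL that in auto)
  have lap2: "laplace (\<lambda>y. ennreal y * (ennreal y * u y)) \<gamma> = ennreal (L2 \<gamma>)" if "0 < \<gamma>" for \<gamma>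
    by (rule laplace_times_ident[where \<gamma>\<^sub>0=0 and L=L1]) (use lap1 L_nonneg DL1 that in auto)
  have lapK: "laplace (conv K u) \<gamma> = ennreal (L2 \<gamma>)" if "0 < \<gamma>" for \<gamma>
  proof -
    have "laplace K \<gamma> = ennreal (t * l / 2 * \<gamma> powr (- (3 / 2)) + t\<^sup>2 * l\<^sup>2 * \<gamma> powr (- 1))"
      unfolding K_def using that t l
      by (simp add: laplace_add laplace_cmult laplace_rl_kernel ennreal_mult[symmetric] del: ennreal_mult)
    also have "\<gamma> powr (- (3 / 2)) = 1 / (\<gamma> * sqrt \<gamma>)"
      using that powr_add[of \<gamma> 1 "1 / 2"] by (simp add: powr_minus_divide powr_half_sqrt)
    also have "t * l / 2 * (1 / (\<gamma> * sqrt \<gamma>)) + t\<^sup>2 * l\<^sup>2 * \<gamma> powr (- 1) = t * l / (2 * \<gamma> * sqrt \<gamma>) + t\<^sup>2 * l\<^sup>2 / \<gamma>"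
      using that by (simp add: powr_minus_divide)
    finally show ?thesis
      using that t l L_nonneg by (simp add: laplace_conv u L2_def ennreal_mult)
  qed
  have "AE y in lborel. 0 < y \<longrightarrow> ennreal y * (ennreal y * u y) = conv K u y"
    by (rule laplace_unique[where \<gamma>\<^sub>0=1]) (auto simp: lap2 lapK)
  \<comment> \<open>As an equation with \<open>max\<close>, the inequality can be carried from
    almost every y to every y by continuity.\<close>
  then have "AE y in lborel. y \<in> {0<..} \<longrightarrow> max 0 (y\<^sup>2 * h (y + t) t - B y) = 0"
  proof eventually_elim
    case (elim y)
    have "y\<^sup>2 * h (y + t) t \<le> B y" if y: "0 < y"
    proof -
      have "ennreal (y\<^sup>2 * h (y + t) t) = ennreal y * (ennreal y * u y)"
        using y t h_nonneg[OF t] by (simp add: u_def H_eq ennreal_mult[symmetric] power2_eq_square mult.assoc)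
      also have "\<dots> = conv K u y"
        using elim y by simp
      also have "\<dots> \<le> K y * (ennreal (exp (\<bar>1 / y\<bar> * y)) * laplace u (1 / y))"
      proof (rule conv_le)
        \<comment> \<open>Both orders in \<open>K\<close> are at least 1, so \<open>K\<close> is
          nondecreasing and can be replaced by its value at y.\<close>
        fix z :: real
        assume "0 < z" "z < y"
        then show "K z \<le> K y"
          unfolding K_def rl_kernel_def using G32
          by (intro add_mono mult_left_mono ennreal_leI divide_right_mono powr_mono2) auto
      qed auto
      also have "K y = ennreal (t * l / 2 * (sqrt y / Gamma (3 / 2)) + t\<^sup>2 * l\<^sup>2)"
        unfolding K_def rl_kernel_def using G32 y t l
        by (simp add: ennreal_mult[symmetric] powr_half_sqrt)
      also have "ennreal (exp (\<bar>1 / y\<bar> * y)) * laplace u (1 / y) = ennreal (exp (1 - 2 * l * t / sqrt y))"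
        using y by (simp add: u L_def ennreal_mult[symmetric] exp_add[symmetric] real_sqrt_divide)
      also have "ennreal (t * l / 2 * (sqrt y / Gamma (3 / 2)) + t\<^sup>2 * l\<^sup>2) * ennreal (exp (1 - 2 * l * t / sqrt y)) = ennreal (B y)"
        unfolding B_def using G32 y t l by (subst ennreal_mult) auto
      finally show ?thesis
        using G32 y t l by (subst (asm) ennreal_le_iff) (auto simp: B_def)
    qed
    then show ?case
      by auto
  qed
  moreover have "continuous_on {0<..} (\<lambda>y. y\<^sup>2 * h (y + t) t - B y)"
  proof -
    have "continuous_on {0<..} (\<lambda>y. h (y + t) t)"
      by (rule continuous_on_compose2[OF h_continuous[OF t]]) (use t in \<open>auto intro!: continuous_intros\<close>)
    then show ?thesis
      unfolding B_def by (intro continuous_intros) (auto simp: less_imp_neq[OF G32, symmetric])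
  qed
  ultimately have "max 0 (y\<^sup>2 * h (y + t) t - B y) = 0"
    using y by (intro AE_eq_imp_eq_on_open[where f="\<lambda>y. max 0 (y\<^sup>2 * h (y + t) t - B y)" and S="{0<..}"])
      (auto intro!: continuous_on_max)
  then show ?thesis
    by (simp add: B_def)
qed

text \<open>After division by y^2 the bound of \<open>h_bound\<close> is dangerous only for small y
  = x - t. There t exceeds a/2, and the exponential decay in 1 / sqrt y beats y^(-2).\<close>

lemma h_locally_bounded:
  assumes a: "0 < a"
  obtains C where "\<And>x t. x \<in> {a..b} \<Longrightarrow> 0 < t \<Longrightarrow> t < x \<Longrightarrow> h x t \<le> C"
proof -
  define D where "D = b * l / 2 * (sqrt b / Gamma (3 / 2)) + b\<^sup>2 * l\<^sup>2"
  \<comment> \<open>The two entries belong to the cases y \<ge> a/2, where 1 \<le> 4 y^2 / a^2, and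
    y < a/2, where 2 l t \<ge> a l. \<open>D\<close> bounds the prefactor, as t and y are at most
    b.\<close>
  define E where "E = max (4 / a\<^sup>2) (256 / (l * a) ^ 4)"
  have G32: "0 < Gamma (3 / 2 :: real)"
    by (rule Gamma_real_pos) simp
  show thesis
  proof
    fix x t :: real
    assume x: "x \<in> {a..b}" and t: "0 < t" "t < x"
    define y where "y = x - t"
    have y: "0 < y" "y \<le> b" "t \<le> b" "x = y + t" "a \<le> y + t"
      using x t by (auto simp: y_def)
    have D: "0 \<le> D"
      unfolding D_def using G32 y l by simp
    have K: "t * l / 2 * (sqrt y / Gamma (3 / 2)) + t\<^sup>2 * l\<^sup>2 \<le> D"
      unfolding D_def using G32 y t l
      by (intro add_mono mult_mono divide_right_mono real_sqrt_le_mono power_mono) auto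
    have "exp (- (2 * l * t / sqrt y)) \<le> E * y\<^sup>2"
    proof (cases "a / 2 \<le> y")
      case True
      have "exp (- (2 * l * t / sqrt y)) \<le> 1"
        using y t l by simp
      also have "1 \<le> 4 / a\<^sup>2 * y\<^sup>2"
        using power_mono[OF True, of 2] a by (simp add: field_simps power2_eq_square)
      also have "\<dots> \<le> E * y\<^sup>2"
        unfolding E_def by (intro mult_right_mono) auto
      finally show ?thesis .
    next
      case False
      then have "a * l / sqrt y \<le> 2 * l * t / sqrt y"
        using y l by (intro divide_right_mono) (auto simp: mult.commute)
      then have "exp (- (2 * l * t / sqrt y)) \<le> exp (- (a * l / sqrt y))"
        by simp
      also have "\<dots> \<le> 256 / (a * l / sqrt y) ^ 4"
        using y a l by (intro exp_minus_le_inverse_power4) auto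
      also have "\<dots> = 256 / (l * a) ^ 4 * y\<^sup>2"
      proof -
        have "sqrt y ^ 4 = y\<^sup>2"
          using y power_mult[of "sqrt y" 2 2] by simp
        then show ?thesis
          by (simp add: power_divide mult.commute)
      qed
      also have "\<dots> \<le> E * y\<^sup>2"
        unfolding E_def by (intro mult_right_mono) auto
      finally show ?thesis .
    qed
    then have "exp (1 - 2 * l * t / sqrt y) \<le> exp 1 * (E * y\<^sup>2)"
      by (simp add: exp_diff exp_minus field_simps)
    then have "(t * l / 2 * (sqrt y / Gamma (3 / 2)) + t\<^sup>2 * l\<^sup>2) * exp (1 - 2 * l * t / sqrt y)
      \<le> D * (exp 1 * (E * y\<^sup>2))"
      using D by (intro mult_mono K) auto
    with h_bound[OF t(1) y(1)] have "y\<^sup>2 * h x t \<le> y\<^sup>2 * (D * exp 1 * E)"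
      by (simp add: y(4)[symmetric] mult_ac)
    then show "h x t \<le> D * exp 1 * E"
      using y(1) by simp
  qed
qed

lemma mix_eq_G'_half:
  assumes x: "0 < x"
  shows "mix (rl_kernel 1) x = G' x"
proof (rule mix_eq_G'I[OF _ x])
  have rl: "rl_kernel 1 t = 1" if "0 < t" for t
    using that by (simp add: rl_kernel_def)
  have "isCont (\<lambda>x. ennreal x * mix (rl_kernel 1) x) x" if x: "0 < x" for x
  proof -
    define a b where "a = x / 2" and "b = 2 * x"
    have ab: "0 < a" "a < x" "x < b"
      using x by (auto simp: a_def b_def)
    obtain C where C: "\<And>x t. x \<in> {a..b} \<Longrightarrow> 0 < t \<Longrightarrow> t < x \<Longrightarrow> h x t \<le> C"
      using h_locally_bounded[OF ab(1)] by metis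
    define f where "f x t = ennreal x * (ennreal (exp (- \<mu> * t)) * rl_kernel 1 t * H x t)" for x t
    have [measurable]: "f x \<in> borel_measurable borel" for x
      unfolding f_def by measurable
    have fm: "ennreal x * mix (rl_kernel 1) x = (\<integral>\<^sup>+t. f x t \<partial>lborel)" for x
      unfolding f_def mix_def by (rule nn_integral_cmult[symmetric]) measurable
    have "continuous_on {a..b} (\<lambda>x. \<integral>\<^sup>+t. f x t \<partial>lborel)"
      unfolding continuous_on_sequentially comp_def
    proof safe
      fix u :: "nat \<Rightarrow> real" and x
      assume x: "x \<in> {a..b}" and u: "\<forall>n. u n \<in> {a..b}" "u \<longlonglongrightarrow> x"
      have pos: "0 < x" "0 < u n" for n
        using ab x u(1)[rule_format, of n] by auto
      show "(\<lambda>n. \<integral>\<^sup>+t. f (u n) t \<partial>lborel) \<longlonglongrightarrow> (\<integral>\<^sup>+t. f x t \<partial>lborel)"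
      proof (rule nn_integral_dominated_convergence[where w="\<lambda>t. ennreal (b * C) * indicator {0..b} t"])
        show "AE t in lborel. f (u n) t \<le> ennreal (b * C) * indicator {0..b} t" for n
          \<comment> \<open>For t < u n the local bound applies and for t > u n the density
            vanishes; neither covers t = u n, a null set.\<close>
          using AE_lborel_singleton[of "u n"]
        proof eventually_elim
          case (elim t)
          have un: "u n \<in> {a..b}"
            using u(1) by blast
          consider "t \<le> 0" | "u n < t" | "0 < t" "t < u n"
            using elim by linarith
          then show ?case
          proof cases
            case 3
            have "h (u n) t \<le> C"
              using C[OF un] 3 by blast
            moreover have "exp (- \<mu> * t) \<le> 1"
              using 3 \<mu> by simp
            ultimately have "u n * (exp (- \<mu> * t) * h (u n) t) \<le> b * (1 * C)"
              using un pos h_nonneg[OF 3(1)] ab by (intro mult_mono) auto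
            then have "f (u n) t \<le> ennreal (b * C)"
              unfolding f_def using 3 pos h_nonneg[OF 3(1)]
              by (simp add: rl H_eq ennreal_mult[symmetric] ennreal_leI del: ennreal_mult)
            then show ?thesis
              using 3 un by simp
          qed (auto simp: f_def H_def zero pos)
        qed
        show "(\<integral>\<^sup>+t. ennreal (b * C) * indicator {0..b} t \<partial>lborel) < \<infinity>"
          by (subst nn_integral_cmult) (auto simp: ennreal_mult_less_top emeasure_lborel_Icc_eq)
        show "AE t in lborel. (\<lambda>n. f (u n) t) \<longlonglongrightarrow> f x t"
        proof (rule AE_I2)
          fix t :: real
          show "(\<lambda>n. f (u n) t) \<longlonglongrightarrow> f x t"
          proof (cases "0 < t")
            case True
            have "isCont (\<lambda>x. h x t) x"
              using h_continuous[OF True] pos by (simp add: continuous_on_eq_continuous_at)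
            then have "(\<lambda>n. h (u n) t) \<longlonglongrightarrow> h x t"
              using u(2) by (rule isCont_tendsto_compose)
            then have "(\<lambda>n. ennreal (u n * (exp (- \<mu> * t) * h (u n) t))) \<longlonglongrightarrow> ennreal (x * (exp (- \<mu> * t) * h x t))"
              using u(2) by (intro tendsto_ennrealI tendsto_intros)
            then show ?thesis
              unfolding f_def using True pos h_nonneg[OF True]
              by (simp add: rl H_eq ennreal_mult less_imp_le)
          qed (simp add: f_def H_eq_0)
        qed
      qed auto
    qed
    then have "continuous_on {a..b} (\<lambda>x. ennreal x * mix (rl_kernel 1) x)"
      by (simp add: fm)
    then show ?thesis
      by (rule continuous_on_interior) (use ab in auto)
  qed
  then show "continuous_on {0<..} (\<lambda>x. ennreal x * mix (rl_kernel 1) x)"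
    by (simp add: continuous_at_imp_continuous_on)
qed

end

end

section \<open>From extended integrals to the formula\<close>

theorem (in time_changed_density) laplace_density_eq:
  assumes "\<nu> \<le> 1 / 2" and zero: "\<And>x t. \<nu> = 1 / 2 \<Longrightarrow> 0 < x \<Longrightarrow> x < t \<Longrightarrow> h x t = 0"
    and x: "0 < x"
  shows "set_integrable lborel {0<..} (\<lambda>t. exp (- \<mu> * t) * h x t)"
    and "(LBINT t:{0<..}. exp (- \<mu> * t) * h x t) = G x"
proof -
  have mix: "mix (rl_kernel 1) x = G' x"
    using mix_eq_G'_less_half[OF _ x] mix_eq_G'_half[OF _ _ x] zero assms(1) by fastforce
  let ?f = "\<lambda>t. indicator {0<..} t *\<^sub>R (exp (- \<mu> * t) * h x t)"
  have f: "ennreal (?f t) = ennreal (exp (- \<mu> * t)) * rl_kernel 1 t * H x t" for t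
    using x h_nonneg[of t x] by (cases "0 < t") (simp_all add: rl_kernel_def H_def ennreal_mult)
  have f_nonneg: "0 \<le> ?f t" for t
    using h_nonneg[of t x] by (simp add: indicator_def)
  have "(\<lambda>t. enn2real (ennreal (?f t))) \<in> borel_measurable borel"
    unfolding f by measurable
  then have f_meas: "?f \<in> lborel \<rightarrow>\<^sub>M borel"
    using f_nonneg by simp
  have "(\<integral>\<^sup>+t. ennreal (?f t) \<partial>lborel) = ennreal (G x)"
    using mix x unfolding f by (simp add: mix_def G'_def)
  then have "integrable lborel ?f \<and> integral\<^sup>L lborel ?f = G x"
    by (simp only: nn_integral_eq_integrable[OF f_meas AE_I2[OF f_nonneg] mix_eq_G_AE(2)[OF x]])
  then show "set_integrable lborel {0<..} (\<lambda>t. exp (- \<mu> * t) * h x t)"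
    and "(LBINT t:{0<..}. exp (- \<mu> * t) * h x t) = G x"
    by (simp_all add: set_integrable_def set_lebesgue_integral_def)
qed

theorem mainTheorem8:
  fixes M :: "'a measure"
    and H1 H2 :: "real \<Rightarrow> 'a \<Rightarrow> real"
    and h :: "real \<Rightarrow> real \<Rightarrow> real"
    and \<nu> l \<mu> x :: real
  assumes "prob_space M"
    and "0 < \<nu>" and "\<nu> \<le> 1 / 2" and "0 < l"
    and "stable_subordinator M (2 * \<nu>) H1"
    and "stable_subordinator M \<nu> H2"
    and "indep_processes M H1 H2"
    and "law_density M (\<lambda>t \<omega>. H1 t \<omega> + (2 * l) powr (1 / \<nu>) * H2 t \<omega>) h"
    and "0 < x" and "0 < \<mu>" and "\<mu> < l\<^sup>2"
  shows "let s = sqrt (l\<^sup>2 - \<mu>); r1 = - l + s; r2 = - l - s in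
      set_integrable lborel {0<..} (\<lambda>t. exp (- \<mu> * t) * h x t) \<and>
      (LBINT t:{0<..}. exp (- \<mu> * t) * h x t) =
        x powr (\<nu> - 1) / (2 * s) *
          (mittag_leffler \<nu> \<nu> (r1 * x powr \<nu>) - mittag_leffler \<nu> \<nu> (r2 * x powr \<nu>)) \<and>
      (\<lambda>y. mittag_leffler \<nu> 1 (r1 * y powr \<nu>)) field_differentiable at x \<and>
      (\<lambda>y. mittag_leffler \<nu> 1 (r2 * y powr \<nu>)) field_differentiable at x \<and>
      x powr (\<nu> - 1) / (2 * s) *
          (mittag_leffler \<nu> \<nu> (r1 * x powr \<nu>) - mittag_leffler \<nu> \<nu> (r2 * x powr \<nu>)) =
        1 / (2 * s) *
          (1 / r1 * deriv (\<lambda>y. mittag_leffler \<nu> 1 (r1 * y powr \<nu>)) x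
           - 1 / r2 * deriv (\<lambda>y. mittag_leffler \<nu> 1 (r2 * y powr \<nu>)) x)"
proof -
  note a = assms(1-8)
  define X where "X = (\<lambda>t \<omega>. H1 t \<omega> + (2 * l) powr (1 / \<nu>) * H2 t \<omega>)"
  have c: "0 < (2 * l) powr (1 / \<nu>)"
    using a by simp
  note law = a(1,5,6,7) X_def a(8)[folded X_def] c
  interpret time_changed_density \<nu> l \<mu> h
  proof
    fix t \<gamma> :: real
    assume t: "0 < t"
    show "0 \<le> h x t" for x
      by (rule law_densityD(1)[OF law t])
    show "continuous_on {0<..} (\<lambda>x. h x t)"
      by (rule law_densityD(3)[OF law t])
    assume \<gamma>: "0 < \<gamma>"
    \<comment> \<open>The scale (2 l)^(1/\<nu>) of the second subordinator becomes 2 l after raising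
      to the power \<nu>, so the exponent is a quadratic polynomial in \<gamma>^\<nu>.\<close>
    have "((2 * l) powr (1 / \<nu>) * \<gamma>) powr \<nu> = 2 * l * \<gamma> powr \<nu>"
      using a \<gamma> by (simp add: powr_mult powr_powr)
    then show "laplace (\<lambda>x. ennreal (h x t)) \<gamma> = ennreal (exp (- t * (\<gamma> powr (2 * \<nu>) + 2 * l * \<gamma> powr \<nu>)))"
      using laplace_law_density[OF law t \<gamma>] by simp
  qed (use assms borel_measurable_law_density[OF law] in auto)
  have zero: "h y t = 0" if "\<nu> = 1 / 2" "0 < y" "y < t" for y t
    by (rule law_density_eq_0[OF law _ that(2,3)]) (use that in simp)
  \<comment> \<open>Since \<mu> > 0 the square root is strictly below l, so neither root vanishes
    and the second form may divide by them.\<close>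
  have r: "- l + sqrt (l\<^sup>2 - \<mu>) \<noteq> 0" "- l - sqrt (l\<^sup>2 - \<mu>) \<noteq> 0"
    using sqrt_bounds l by linarith+
  have D: "((\<lambda>y. mittag_leffler \<nu> 1 (r * y powr \<nu>)) has_field_derivative
      r * (x powr (\<nu> - 1) * mittag_leffler \<nu> \<nu> (r * x powr \<nu>))) (at x)" for r
    by (rule DERIV_mittag_leffler_powr[OF \<nu> assms(9)])
  show ?thesis
    unfolding Let_def
  proof (intro conjI)
    show "set_integrable lborel {0<..} (\<lambda>t. exp (- \<mu> * t) * h x t)"
      by (rule laplace_density_eq(1)[OF assms(3) zero assms(9)])
    show "(LBINT t:{0<..}. exp (- \<mu> * t) * h x t) = x powr (\<nu> - 1) / (2 * sqrt (l\<^sup>2 - \<mu>)) *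
        (mittag_leffler \<nu> \<nu> ((- l + sqrt (l\<^sup>2 - \<mu>)) * x powr \<nu>) - mittag_leffler \<nu> \<nu> ((- l - sqrt (l\<^sup>2 - \<mu>)) * x powr \<nu>))"
      using laplace_density_eq(2)[OF assms(3) zero assms(9)] by (simp only: G_def)
  next
    show "(\<lambda>y. mittag_leffler \<nu> 1 ((- l + sqrt (l\<^sup>2 - \<mu>)) * y powr \<nu>)) field_differentiable at x"
      "(\<lambda>y. mittag_leffler \<nu> 1 ((- l - sqrt (l\<^sup>2 - \<mu>)) * y powr \<nu>)) field_differentiable at x"
      using D unfolding field_differentiable_def by blast+
  qed (use r in \<open>simp add: DERIV_imp_deriv[OF D] right_diff_distrib\<close>)
qed

end
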